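(* Let $P$ be a Fano polygon, let $v$ be a vertex of the quiver $Q_P$ corresponding to a primitive $T$-cone in $P$, and let $P'$ be the corresponding mutation of $P$ (that is, the mutation of $P$ with respect to the primitive inner normal vector $w$ of the edge of $P$ determined by that primitive $T$-cone). Then $Q_{P'}=\operatorname{mut}(Q_P,v)$.
   Context: Let $N\cong\mathbb{Z}^2$, $N_{\mathbb{Q}}=N\otimes_{\mathbb{Z}}\mathbb{Q}$, $M=\operatorname{Hom}(N,\mathbb{Z})$. A Fano polygon is a convex polygon $P\subset N_{\mathbb{Q}}$ whose vertices are primitive lattice points of $N$ and which contains the origin in its strict interior. Primitive $T$-cones. For an edge $E$ of $P$ with primitive inner normal $w_E\in M$, the height is $r_E=-w_E(E)>0$ and the width is $k_E=|E\cap N|-1$. Write $k_E=n_Er_E+k_0$ with $0\leq k_0<r_E$. The edge can be subdivided into $n_E$ lattice segments of width $r_E$ and, if $k_0\neq 0$, one lattice segment of width $k_0$. The cones over the $n_E$ segments of width $r_E$ are called primitive $T$-cones; each determines the edge $E$. Let $n=\sum_E n_E$. Quiver of $P$. Write $\wedge$ for the determinant on $M\cong\mathbb{Z}^2$ (with respect to a fixed basis). The quiver $Q_P$ has $n$ vertices, one for each primitive $T$-cone; if $v,v'$ are vertices whose primitive $T$-cones determine edges with primitive inner normals $w,w'$, then the number of arrows from $v$ to $v'$ is $\max\{w\wedge w',0\}$. Quivers are considered up to isomorphism. Quiver mutation. Given a quiver $Q$ and a vertex $v$, $\operatorname{mut}(Q,v)$ is obtained from $Q$ by: (1) adding, for each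 subquiver $v_1\to v\to v_2$, an arrow from $v_1$ to $v_2$; (2) deleting a maximal set of disjoint two-cycles; (3) reversing all arrows incident to $v$. The result is well-defined up to isomorphism. Mutation of polygons. Let $w\in M$ be the primitive inner normal vector of an edge $E$ of $P$, let $h_{\min}=\min_{v\in P}w(v)=-r_E<0$ and $h_{\max}=\max_{v\in P}w(v)>0$. For $h\in\mathbb{Z}$ let $w_h(P)$ be the (possibly empty) convex hull of $\{v\in P\cap N: w(v)=h\}$. Let $v_E\in N$ be primitive with $w(v_E)=0$ (unique up to sign) and $F=\operatorname{conv}\{0,v_E\}$. Suppose that for every integer $h$ with $h_{\min}\leq h<0$ there is a (possibly empty) lattice polytope $G_h\subset N_{\mathbb{Q}}$ with $\{v \text{ a vertex of } P: w(v)=h\}\subseteq G_h+|h|F\subseteq w_h(P)$ (Minkowski sum, with $\varnothing+Q=\varnothing$). Then the mutation of $P$ with respect to $w$ is $\operatorname{mut}_w(P,F)=\operatorname{conv}\big(\bigcup_{h=h_{\min}}^{-1}G_h\cup\bigcup_{h=0}^{h_{\max}}(w_h(P)+hF)\big)$. It is again a Fano polygon, is independent of the choice of $\{G_h\}$, and changing the sign of $v_E$ changes the result only by a shear transformation fixing $w^\perp$. *)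

theory Defs
  imports "HOL-Analysis.Analysis" "Graph_Theory.Digraph_Isomorphism"
begin

section \<open>The lattice plane and its dual\<close>

text \<open>
  A basis of the lattice \<open>N\<close> is fixed, so that elements of \<open>N\<close>, and elements of \<open>M = Hom(N, Z)\<close>
  in the dual basis, are both integer pairs. All polygons are taken in the real plane \<open>N \<otimes> R\<close>,
  where the library's convexity notions live, rather than in the rational plane. Lattice polygons
  are the convex hulls of their lattice vertices, so the two settings describe the same polygons.
\<close>

definition lattice_point :: "int \<times> int \<Rightarrow> real \<times> real" where
  "lattice_point u = (real_of_int (fst u), real_of_int (snd u))"

definition lattice_points :: "(real \<times> real) set" where
  "lattice_points = range lattice_point"

text \<open>Since \<open>gcd 0 0 = 0\<close>, the zero vector is not primitive.\<close>

definition primitive :: "int \<times> int \<Rightarrow> bool" where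
  "primitive u \<longleftrightarrow> coprime (fst u) (snd u)"

definition pairing :: "int \<times> int \<Rightarrow> real \<times> real \<Rightarrow> real" where
  "pairing w x = real_of_int (fst w) * fst x + real_of_int (snd w) * snd x"

definition wedge :: "int \<times> int \<Rightarrow> int \<times> int \<Rightarrow> int" where
  "wedge w w' = fst w * snd w' - snd w * fst w'"

section \<open>Fano polygons and primitive T-cones\<close>

definition fano_polygon :: "(real \<times> real) set \<Rightarrow> bool" where
  "fano_polygon P \<longleftrightarrow>
     polytope P \<and>
     (\<forall>x. x extreme_point_of P \<longrightarrow> (\<exists>u. primitive u \<and> x = lattice_point u)) \<and>
     0 \<in> interior P"

definition is_inner_normal :: "(real \<times> real) set \<Rightarrow> (real \<times> real) set \<Rightarrow> int \<times> int \<Rightarrow> bool" where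
  "is_inner_normal P E w \<longleftrightarrow>
     primitive w \<and>
     (\<exists>h. E = {x \<in> P. pairing w x = h} \<and> (\<forall>x\<in>P. h \<le> pairing w x))"

definition inner_normal :: "(real \<times> real) set \<Rightarrow> (real \<times> real) set \<Rightarrow> int \<times> int" where
  "inner_normal P E = (THE w. is_inner_normal P E w)"

definition edge_height :: "(real \<times> real) set \<Rightarrow> (real \<times> real) set \<Rightarrow> nat" where
  "edge_height P E = (THE r. pairing (inner_normal P E) ` E = {- real r})"

definition width :: "(real \<times> real) set \<Rightarrow> nat" where
  "width S = card (S \<inter> lattice_points) - 1"

definition lattice_segment :: "(real \<times> real) set \<Rightarrow> bool" where
  "lattice_segment S \<longleftrightarrow>
     (\<exists>a\<in>lattice_points. \<exists>b\<in>lattice_points. a \<noteq> b \<and> S = closed_segment a b)"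

text \<open>
  A subdivision of an edge \<open>E\<close> of height \<open>r\<close> and width \<open>k\<close> into \<open>k div r\<close> lattice segments of
  width \<open>r\<close> and, unless \<open>k mod r = 0\<close>, one further lattice segment of width \<open>k mod r\<close>. In the
  latter case the subdivision is not unique (the short segment can be placed in several
  positions), so the choice is carried along as a parameter.
\<close>

definition edge_subdivision ::
  "(real \<times> real) set \<Rightarrow> (real \<times> real) set \<Rightarrow> (real \<times> real) set set \<Rightarrow> bool" where
  "edge_subdivision P E \<S> \<longleftrightarrow>
     finite \<S> \<and> (\<forall>S\<in>\<S>. lattice_segment S) \<and> \<Union>\<S> = E \<and>
     pairwise (\<lambda>S T. disjnt (rel_interior S) (rel_interior T)) \<S> \<and>
     (let r = edge_height P E; k = width E in
        card {S \<in> \<S>. width S = r} = k div r \<and>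
        (if k mod r = 0 then {S \<in> \<S>. width S \<noteq> r} = {}
         else \<exists>S. {S \<in> \<S>. width S \<noteq> r} = {S} \<and> width S = k mod r))"

definition polygon_subdivision ::
  "(real \<times> real) set \<Rightarrow> ((real \<times> real) set \<Rightarrow> (real \<times> real) set set) \<Rightarrow> bool" where
  "polygon_subdivision P \<sigma> \<longleftrightarrow> (\<forall>E. E edge_of P \<longrightarrow> edge_subdivision P E (\<sigma> E))"

definition primitive_T_cones ::
  "(real \<times> real) set \<Rightarrow> ((real \<times> real) set \<Rightarrow> (real \<times> real) set set) \<Rightarrow> (real \<times> real) set set" where
  "primitive_T_cones P \<sigma> =
     {conic hull S | S E. E edge_of P \<and> S \<in> \<sigma> E \<and> width S = edge_height P E}"

definition cone_edge :: "(real \<times> real) set \<Rightarrow> (real \<times> real) set \<Rightarrow> (real \<times> real) set" where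
  "cone_edge P C = (THE E. E edge_of P \<and> C \<subseteq> conic hull E)"

definition cone_normal :: "(real \<times> real) set \<Rightarrow> (real \<times> real) set \<Rightarrow> int \<times> int" where
  "cone_normal P C = inner_normal P (cone_edge P C)"

section \<open>The quiver of a Fano polygon\<close>

text \<open>
  Quivers are the multi-digraphs of the digraph library; an arc \<open>(C, D, i)\<close> is the \<open>i\<close>-th arrow
  from \<open>C\<close> to \<open>D\<close>.
\<close>

definition polygon_quiver ::
  "(real \<times> real) set \<Rightarrow> ((real \<times> real) set \<Rightarrow> (real \<times> real) set set) \<Rightarrow>
   ((real \<times> real) set, (real \<times> real) set \<times> (real \<times> real) set \<times> nat) pre_digraph" where
  "polygon_quiver P \<sigma> =
     \<lparr>verts = primitive_T_cones P \<sigma>,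
      arcs = {(C, D, i). C \<in> primitive_T_cones P \<sigma> \<and> D \<in> primitive_T_cones P \<sigma> \<and>
                int i < max (wedge (cone_normal P C) (cone_normal P D)) 0},
      tail = (\<lambda>(C, D, i). C),
      head = (\<lambda>(C, D, i). D)\<rparr>"

section \<open>Mutation of quivers\<close>

definition add_composite_arrows ::
  "('v, 'a) pre_digraph \<Rightarrow> 'v \<Rightarrow> ('v, 'a + 'a \<times> 'a) pre_digraph" where
  "add_composite_arrows Q v =
     \<lparr>verts = verts Q,
      arcs = Inl ` arcs Q \<union>
             Inr ` {(a, b). a \<in> arcs Q \<and> b \<in> arcs Q \<and> head Q a = v \<and> tail Q b = v},
      tail = case_sum (tail Q) (\<lambda>(a, b). tail Q a),
      head = case_sum (head Q) (\<lambda>(a, b). head Q b)\<rparr>"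

definition two_cycle :: "('v, 'a) pre_digraph \<Rightarrow> 'a set \<Rightarrow> bool" where
  "two_cycle Q D \<longleftrightarrow>
     (\<exists>a\<in>arcs Q. \<exists>b\<in>arcs Q. D = {a, b} \<and> tail Q a \<noteq> head Q a \<and>
        tail Q b = head Q a \<and> head Q b = tail Q a)"

definition disjoint_two_cycles :: "('v, 'a) pre_digraph \<Rightarrow> 'a set set \<Rightarrow> bool" where
  "disjoint_two_cycles Q \<D> \<longleftrightarrow> (\<forall>D\<in>\<D>. two_cycle Q D) \<and> disjoint \<D>"

definition maximal_disjoint_two_cycles :: "('v, 'a) pre_digraph \<Rightarrow> 'a set set \<Rightarrow> bool" where
  "maximal_disjoint_two_cycles Q \<D> \<longleftrightarrow>
     disjoint_two_cycles Q \<D> \<and> (\<forall>\<D>'. disjoint_two_cycles Q \<D>' \<and> \<D> \<subseteq> \<D>' \<longrightarrow> \<D>' = \<D>)"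

definition reverse_arrows_at :: "('v, 'a) pre_digraph \<Rightarrow> 'v \<Rightarrow> ('v, 'a) pre_digraph" where
  "reverse_arrows_at Q v =
     Q\<lparr>tail := (\<lambda>a. if tail Q a = v \<or> head Q a = v then head Q a else tail Q a),
       head := (\<lambda>a. if tail Q a = v \<or> head Q a = v then tail Q a else head Q a)\<rparr>"

text \<open>
  The mutation depends, up to isomorphism only, on the maximal set of disjoint two-cycles that is
  deleted; it is therefore a relation between \<open>Q\<close> and the possible results \<open>Q'\<close>.
\<close>

definition quiver_mutation ::
  "('v, 'a) pre_digraph \<Rightarrow> 'v \<Rightarrow> ('v, 'a + 'a \<times> 'a) pre_digraph \<Rightarrow> bool" where
  "quiver_mutation Q v Q' \<longleftrightarrow>
     (\<exists>\<D>. maximal_disjoint_two_cycles (add_composite_arrows Q v) \<D> \<and>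
          Q' = reverse_arrows_at
                 ((add_composite_arrows Q v)\<lparr>arcs := arcs (add_composite_arrows Q v) - \<Union>\<D>\<rparr>) v)"

lemma quiver_mutation_exists:
  assumes "finite (arcs Q)"
  shows "\<exists>Q'. quiver_mutation Q v Q'"
proof -
  let ?Q = "add_composite_arrows Q v"
  have "finite {(a, b). a \<in> arcs Q \<and> b \<in> arcs Q \<and> head Q a = v \<and> tail Q b = v}"
    by (rule finite_subset[of _ "arcs Q \<times> arcs Q"]) (use assms in auto)
  then have fin: "finite (arcs ?Q)"
    using assms by (simp add: add_composite_arrows_def)
  have "{\<D>. disjoint_two_cycles ?Q \<D>} \<subseteq> Pow (Pow (arcs ?Q))"
    by (auto simp: disjoint_two_cycles_def two_cycle_def)
  then have "finite {\<D>. disjoint_two_cycles ?Q \<D>}"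
    using fin by (meson finite_Pow_iff finite_subset)
  moreover have "{} \<in> {\<D>. disjoint_two_cycles ?Q \<D>}"
    by (simp add: disjoint_two_cycles_def)
  ultimately obtain \<D> where "maximal_disjoint_two_cycles ?Q \<D>"
    using finite_has_maximal2[of "{\<D>. disjoint_two_cycles ?Q \<D>}" "{}"]
    unfolding maximal_disjoint_two_cycles_def by auto
  then show ?thesis unfolding quiver_mutation_def by blast
qed

section \<open>Mutation of polygons\<close>

definition lattice_polytope :: "(real \<times> real) set \<Rightarrow> bool" where
  "lattice_polytope G \<longleftrightarrow> (\<exists>V. finite V \<and> V \<subseteq> lattice_points \<and> G = convex hull V)"

definition level_hull :: "int \<times> int \<Rightarrow> int \<Rightarrow> (real \<times> real) set \<Rightarrow> (real \<times> real) set" where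
  "level_hull w h P = convex hull {x \<in> P \<inter> lattice_points. pairing w x = real_of_int h}"

definition min_level :: "int \<times> int \<Rightarrow> (real \<times> real) set \<Rightarrow> real" where
  "min_level w P = (INF x\<in>P. pairing w x)"

definition max_level :: "int \<times> int \<Rightarrow> (real \<times> real) set \<Rightarrow> real" where
  "max_level w P = (SUP x\<in>P. pairing w x)"

definition dilate :: "int \<Rightarrow> (real \<times> real) set \<Rightarrow> (real \<times> real) set" where
  "dilate c F = (\<lambda>x. real_of_int c *\<^sub>R x) ` F"

definition mutation_data ::
  "(real \<times> real) set \<Rightarrow> int \<times> int \<Rightarrow> (real \<times> real) set \<Rightarrow> (int \<Rightarrow> (real \<times> real) set) \<Rightarrow> bool" where
  "mutation_data P w F G \<longleftrightarrow>
     (\<forall>h. min_level w P \<le> real_of_int h \<and> h < 0 \<longrightarrow>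
        lattice_polytope (G h) \<and>
        {x. x extreme_point_of P \<and> pairing w x = real_of_int h} \<subseteq> G h + dilate \<bar>h\<bar> F \<and>
        G h + dilate \<bar>h\<bar> F \<subseteq> level_hull w h P)"

definition mutated_polygon ::
  "(real \<times> real) set \<Rightarrow> int \<times> int \<Rightarrow> (real \<times> real) set \<Rightarrow> (int \<Rightarrow> (real \<times> real) set) \<Rightarrow>
   (real \<times> real) set" where
  "mutated_polygon P w F G =
     convex hull
       ((\<Union>h\<in>{h. min_level w P \<le> real_of_int h \<and> h < 0}. G h) \<union>
        (\<Union>h\<in>{h. 0 \<le> h \<and> real_of_int h \<le> max_level w P}. level_hull w h P + dilate h F))"

text \<open>
  \<open>polygon_mutation P w P'\<close> says that \<open>P'\<close> is the mutation of \<open>P\<close> with respect to \<open>w\<close>, for either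
  choice of sign of the primitive vector \<open>f\<close> spanning the kernel of \<open>w\<close> and for any choice of
  the polytopes \<open>G h\<close>.
\<close>

definition polygon_mutation ::
  "(real \<times> real) set \<Rightarrow> int \<times> int \<Rightarrow> (real \<times> real) set \<Rightarrow> bool" where
  "polygon_mutation P w P' \<longleftrightarrow>
     (\<exists>f G. primitive f \<and> pairing w (lattice_point f) = 0 \<and>
        mutation_data P w (convex hull {0, lattice_point f}) G \<and>
        P' = mutated_polygon P w (convex hull {0, lattice_point f}) G)"

end

theory Submission
  imports Defs
begin

text \<open>
  For a primitive covector \<open>u\<close> let \<open>N\<^sub>P(u)\<close> be the number of primitive T-cones of \<open>P\<close> whose edge has
  inner normal \<open>u\<close>. Vertices of the quiver with the same normal have the same arrows, so the quiver
  is determined, up to isomorphism, by the function \<open>N\<^sub>P\<close>: it has \<open>N\<^sub>P(u)\<close> vertices labelled \<open>u\<close>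
  for each \<open>u\<close>, and \<open>max (u \<and> v) 0\<close> arrows from a vertex labelled \<open>u\<close> to one labelled \<open>v\<close>, where
  \<open>\<and>\<close> is the wedge. In particular it does not depend on the chosen subdivisions, because \<open>N\<^sub>P(u)\<close>
  is the integer quotient of the width by the height of the face of \<open>P\<close> on which \<open>u\<close> is minimal
  (\<open>card_T_cones_with_normal\<close>). This quotient makes sense for every primitive \<open>u\<close>; it is zero if
  the face is a vertex.

  Let \<open>w\<close> be the normal of the mutation and \<open>f\<close> the primitive vector in its kernel. On covectors,
  the mutation of the polygon is the piecewise linear bijection
  \<open>\<phi>(u) = u - min 0 (u(f)) w\<close>: the minimum of \<open>\<phi>(u)\<close> on \<open>P'\<close> equals the minimum of
  \<open>u\<close> on \<open>P\<close>, and if \<open>u(f)\<close> is nonzero the two faces of minima agree up to a shear, which preserves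
  lattice widths (\<open>shear_bottom_face\<close>). The only primitive covectors with \<open>u(f) = 0\<close> are \<open>w\<close> and
  \<open>-w\<close>, which \<open>\<phi>\<close> fixes. At \<open>w\<close> the face loses a segment whose width is its height, at \<open>-w\<close> it
  gains one. Hence \<open>N\<^sub>P\<^sub>'(\<phi>(u)) = N\<^sub>P(u)\<close>, except that one T-cone disappears at \<open>w\<close> and one appears
  at \<open>-w\<close>. So the T-cones of \<open>P'\<close> correspond to those of \<open>P\<close> in such a way that \<open>C\<close> is
  relabelled \<open>-w\<close> and every other cone with normal \<open>u\<close> is relabelled \<open>\<phi>(u)\<close>
  (\<open>T_cone_multiplicities\<close>).

  For the arrows, \<open>u(f)\<close> is \<open>w \<and> u\<close> up to a common sign, and expanding \<open>\<phi>(u) \<and> \<phi>(v)\<close> gives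
  \<open>u \<and> v\<close> plus the number of paths \<open>u \<rightarrow> w \<rightarrow> v\<close> minus the number of paths \<open>v \<rightarrow> w \<rightarrow> u\<close>
  (\<open>wedge_mutated_normals\<close>). Adding composite arrows and cancelling two-cycles leaves the
  positive part of this number of arrows, and passing from \<open>w\<close> to \<open>-w\<close> reverses the arrows at \<open>C\<close>.
\<close>

section \<open>Quivers and their arrow counts\<close>

definition arrows :: "('v, 'a) pre_digraph \<Rightarrow> 'v \<Rightarrow> 'v \<Rightarrow> 'a set" where
  "arrows Q x y = {a \<in> arcs Q. tail Q a = x \<and> head Q a = y}"

lemma finite_arrows: "finite (arcs Q) \<Longrightarrow> finite (arrows Q x y)"
  by (simp add: arrows_def)

text \<open>
  Arrows between two given vertices are interchangeable, so a bijection may be chosen separately for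
  every ordered pair. A digraph isomorphism is required to map \<open>Q\<close> onto \<open>R\<close> as a record; taking
  its tail and head maps from \<open>R\<close> achieves this.
\<close>

lemma digraph_iso_of_arrow_counts:
  assumes wf: "wf_digraph Q" "wf_digraph R"
    and fin: "finite (arcs Q)" "finite (arcs R)"
    and g: "bij_betw g (verts Q) (verts R)"
    and counts: "\<And>x y. x \<in> verts Q \<Longrightarrow> y \<in> verts Q \<Longrightarrow>
      card (arrows Q x y) = card (arrows R (g x) (g y))"
  shows "digraph_iso Q R"
proof -
  interpret Q: wf_digraph Q by (rule wf(1))
  interpret R: wf_digraph R by (rule wf(2))
  have "\<exists>k. bij_betw k (arrows Q x y) (arrows R (g x) (g y))"
    if "x \<in> verts Q" "y \<in> verts Q" for x y
    using counts[OF that] finite_arrows[OF fin(1)] finite_arrows[OF fin(2)]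
    by (intro finite_same_card_bij) auto
  then obtain k where k: "\<And>x y. x \<in> verts Q \<Longrightarrow> y \<in> verts Q \<Longrightarrow>
      bij_betw (k x y) (arrows Q x y) (arrows R (g x) (g y))"
    by metis
  define \<kappa> where "\<kappa> a = k (tail Q a) (head Q a) a" for a
  have mem: "\<kappa> a \<in> arrows R (g (tail Q a)) (g (head Q a))" if "a \<in> arcs Q" for a
    using bij_betwE[OF k[of "tail Q a" "head Q a"]] that by (auto simp: \<kappa>_def arrows_def)
  have inj_g: "g x = g y \<longleftrightarrow> x = y" if "x \<in> verts Q" "y \<in> verts Q" for x y
    using g that by (auto simp: bij_betw_def inj_on_def)
  have inj: "inj_on \<kappa> (arcs Q)"
  proof (rule inj_onI)
    fix a b assume ab: "a \<in> arcs Q" "b \<in> arcs Q" and eq: "\<kappa> a = \<kappa> b"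
    then have "tail Q a = tail Q b" "head Q a = head Q b"
      using mem[of a] mem[of b] inj_g by (auto simp: arrows_def)
    moreover have "inj_on (k (tail Q a) (head Q a)) (arrows Q (tail Q a) (head Q a))"
      using k[of "tail Q a" "head Q a"] ab by (simp add: bij_betw_def)
    ultimately show "a = b"
      using ab eq unfolding \<kappa>_def by (auto simp: arrows_def dest: inj_onD)
  qed
  have surj: "\<kappa> ` arcs Q = arcs R"
  proof
    show "\<kappa> ` arcs Q \<subseteq> arcs R"
      using mem by (auto simp: arrows_def)
  next
    show "arcs R \<subseteq> \<kappa> ` arcs Q"
    proof
      fix b assume b: "b \<in> arcs R"
      then obtain x y where xy: "x \<in> verts Q" "y \<in> verts Q" "tail R b = g x" "head R b = g y"
        using g R.tail_in_verts[OF b] R.head_in_verts[OF b]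
        by (metis bij_betw_def imageE)
      then have "b \<in> k x y ` arrows Q x y"
        using k[of x y] b by (auto simp: bij_betw_def arrows_def)
      then show "b \<in> \<kappa> ` arcs Q"
        by (auto simp: arrows_def \<kappa>_def)
    qed
  qed
  let ?f = "\<lparr>iso_verts = g, iso_arcs = \<kappa>, iso_head = head R, iso_tail = tail R\<rparr>"
  have "Q.digraph_isomorphism ?f"
    unfolding Q.digraph_isomorphism_def
    using wf(1) g inj mem by (auto simp: bij_betw_def arrows_def)
  moreover have "R = app_iso ?f Q"
    using surj g by (simp add: app_iso_def bij_betw_def)
  ultimately show ?thesis
    unfolding digraph_iso_def by blast
qed

lemma card_arrows_add_composite:
  assumes "finite (arcs Q)"
  shows "card (arrows (add_composite_arrows Q v) x y) =
         card (arrows Q x y) + card (arrows Q x v) * card (arrows Q v y)"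
proof -
  have "arrows (add_composite_arrows Q v) x y =
        Inl ` arrows Q x y \<union> Inr ` (arrows Q x v \<times> arrows Q v y)"
    by (auto simp: arrows_def add_composite_arrows_def)
  then show ?thesis
    using finite_arrows[OF assms]
    by (simp only:) (subst card_Un_disjoint; auto simp: card_image card_cartesian_product)
qed

lemma finite_arcs_add_composite:
  assumes "finite (arcs Q)"
  shows "finite (arcs (add_composite_arrows Q v))"
proof -
  have "finite {(a, b). a \<in> arcs Q \<and> b \<in> arcs Q \<and> head Q a = v \<and> tail Q b = v}"
    by (rule finite_subset[of _ "arcs Q \<times> arcs Q"]) (use assms in auto)
  then show ?thesis
    using assms by (simp add: add_composite_arrows_def)
qed

text \<open>
  Every deleted arrow belongs to a chosen two-cycle, whose other arrow runs in the opposite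
  direction. Different deleted arrows have different partners since the two-cycles are disjoint.
\<close>

lemma card_deleted_arrows_le:
  assumes "disjoint_two_cycles Q \<D>" "finite (arcs Q)" "x \<noteq> y"
  shows "card (arrows Q x y \<inter> \<Union>\<D>) \<le> card (arrows Q y x \<inter> \<Union>\<D>)"
proof -
  have partner: "\<exists>b. {a, b} \<in> \<D> \<and> b \<in> arrows Q y x" if "a \<in> arrows Q x y \<inter> \<Union>\<D>" for a
  proof -
    from that obtain D where D: "D \<in> \<D>" "a \<in> D" by blast
    then obtain a' b' where "a' \<in> arcs Q" "b' \<in> arcs Q" "D = {a', b'}" "tail Q b' = head Q a'" "head Q b' = tail Q a'"
      using assms(1) unfolding disjoint_two_cycles_def two_cycle_def by metis
    then have "a = a' \<and> {a, b'} \<in> \<D> \<and> b' \<in> arrows Q y x \<or> a = b' \<and> {a, a'} \<in> \<D> \<and> a' \<in> arrows Q y x"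
      using D that by (auto simp: arrows_def insert_commute)
    then show ?thesis by blast
  qed
  then obtain p where p: "\<And>a. a \<in> arrows Q x y \<inter> \<Union>\<D> \<Longrightarrow> {a, p a} \<in> \<D> \<and> p a \<in> arrows Q y x"
    by metis
  have "inj_on p (arrows Q x y \<inter> \<Union>\<D>)"
  proof (rule inj_onI)
    fix a b assume ab: "a \<in> arrows Q x y \<inter> \<Union>\<D>" "b \<in> arrows Q x y \<inter> \<Union>\<D>" "p a = p b"
    then have "{a, p a} \<inter> {b, p b} \<noteq> {}" by auto
    moreover have "disjoint \<D>"
      using assms(1) by (simp add: disjoint_two_cycles_def)
    ultimately have "{a, p a} = {b, p b}"
      using p[OF ab(1)] p[OF ab(2)] disjointD by metis
    moreover have "a \<noteq> p b"
      using ab(1) p[OF ab(2)] assms(3) by (auto simp: arrows_def)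
    ultimately show "a = b" by auto
  qed
  moreover have "p ` (arrows Q x y \<inter> \<Union>\<D>) \<subseteq> arrows Q y x \<inter> \<Union>\<D>"
    using p by blast
  ultimately show ?thesis
    using assms(2) by (intro card_inj_on_le) (auto simp: finite_arrows)
qed

text \<open>
  Equally many arrows are deleted in the two directions, and maximality leaves no arrow in at
  least one of them. This is why the choice of the two-cycles is immaterial.
\<close>

lemma card_arrows_delete_two_cycles:
  assumes max: "maximal_disjoint_two_cycles Q \<D>" and fin: "finite (arcs Q)" and "x \<noteq> y"
  shows "card (arrows Q x y - \<Union>\<D>) = card (arrows Q x y) - card (arrows Q y x)"
proof -
  have disj: "disjoint_two_cycles Q \<D>"
    using max by (simp add: maximal_disjoint_two_cycles_def)
  have split: "card (arrows Q x y) = card (arrows Q x y \<inter> \<Union>\<D>) + card (arrows Q x y - \<Union>\<D>)" for x y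
    using card_Int_Diff finite_arrows[OF fin] by metis
  have eq: "card (arrows Q x y \<inter> \<Union>\<D>) = card (arrows Q y x \<inter> \<Union>\<D>)"
    using card_deleted_arrows_le[OF disj fin] \<open>x \<noteq> y\<close> by (metis antisym)
  have "arrows Q x y - \<Union>\<D> = {} \<or> arrows Q y x - \<Union>\<D> = {}"
  proof (rule ccontr)
    assume "\<not> ?thesis"
    then obtain a b where a: "a \<in> arrows Q x y" "a \<notin> \<Union>\<D>" and b: "b \<in> arrows Q y x" "b \<notin> \<Union>\<D>"
      by blast
    then have "two_cycle Q {a, b}"
      using \<open>x \<noteq> y\<close> by (auto simp: two_cycle_def arrows_def)
    then have "disjoint_two_cycles Q (insert {a, b} \<D>)"
      using disj a b unfolding disjoint_two_cycles_def disjoint_def by auto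
    then have "{a, b} \<in> \<D>"
      using max unfolding maximal_disjoint_two_cycles_def by blast
    then show False using a by blast
  qed
  then show ?thesis
    using eq split[of x y] split[of y x] by (metis add_diff_cancel_left add_diff_cancel_left' card.empty diff_0_eq_0 diff_zero)
qed

lemma arrows_reverse_arrows_at:
  "arrows (reverse_arrows_at Q v) x y = (if x = v \<or> y = v then arrows Q y x else arrows Q x y)"
  by (auto simp: arrows_def reverse_arrows_at_def)

text \<open>
  Loops belong to no two-cycle, so they do not follow this formula; they are dealt with in the next
  lemma.
\<close>

lemma quiver_mutation_arrow_counts:
  assumes mut: "quiver_mutation Q v Q'" and fin: "finite (arcs Q)" and "x \<noteq> y"
  defines "c \<equiv> \<lambda>x y. card (arrows Q x y) + card (arrows Q x v) * card (arrows Q v y)"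
  shows "card (arrows Q' x y) = (if x = v \<or> y = v then c y x - c x y else c x y - c y x)"
proof -
  let ?A = "add_composite_arrows Q v"
  obtain \<D> where \<D>: "maximal_disjoint_two_cycles ?A \<D>"
    and Q': "Q' = reverse_arrows_at (?A\<lparr>arcs := arcs ?A - \<Union>\<D>\<rparr>) v"
    using mut by (auto simp: quiver_mutation_def)
  have del: "arrows (?A\<lparr>arcs := arcs ?A - \<Union>\<D>\<rparr>) x y = arrows ?A x y - \<Union>\<D>" for x y
    by (auto simp: arrows_def)
  show ?thesis
    using card_arrows_delete_two_cycles[OF \<D> finite_arcs_add_composite[OF fin], of x y]
      card_arrows_delete_two_cycles[OF \<D> finite_arcs_add_composite[OF fin], of y x] \<open>x \<noteq> y\<close>
    unfolding Q' arrows_reverse_arrows_at del c_def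
    by (simp add: card_arrows_add_composite[OF fin])
qed

lemma quiver_mutation_loops:
  assumes "quiver_mutation Q v Q'" and "arrows Q x x = {}" and "arrows Q x v = {} \<or> arrows Q v x = {}"
  shows "arrows Q' x x = {}"
proof -
  let ?A = "add_composite_arrows Q v"
  obtain \<D> where Q': "Q' = reverse_arrows_at (?A\<lparr>arcs := arcs ?A - \<Union>\<D>\<rparr>) v"
    using assms(1) by (auto simp: quiver_mutation_def)
  have "arrows Q' x x \<subseteq> arrows ?A x x"
    unfolding Q' arrows_reverse_arrows_at by (auto simp: arrows_def)
  also have "arrows ?A x x = {}"
    using assms(2,3) by (auto simp: arrows_def add_composite_arrows_def)
  finally show ?thesis by simp
qed

lemma wf_digraph_quiver_mutation:
  assumes "quiver_mutation Q v Q'" "wf_digraph Q"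
  shows "wf_digraph Q'"
proof -
  interpret wf_digraph Q by (rule assms(2))
  show ?thesis
    using assms(1)
    by (auto simp: quiver_mutation_def reverse_arrows_at_def add_composite_arrows_def intro!: wf_digraph.intro)
qed

lemma finite_arcs_quiver_mutation:
  assumes "quiver_mutation Q v Q'" "finite (arcs Q)"
  shows "finite (arcs Q')"
  using assms finite_arcs_add_composite[of Q v]
  by (auto simp: quiver_mutation_def reverse_arrows_at_def)

lemma verts_quiver_mutation:
  "quiver_mutation Q v Q' \<Longrightarrow> verts Q' = verts Q"
  by (auto simp: quiver_mutation_def reverse_arrows_at_def add_composite_arrows_def)

section \<open>Primitive vectors and lattice points\<close>

lemma pairing_eq_inner: "pairing w x = lattice_point w \<bullet> x"
  by (simp add: pairing_def lattice_point_def inner_prod_def)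

lemma pairing_lattice_point:
  "pairing u (lattice_point f) = real_of_int (fst u * fst f + snd u * snd f)"
  by (simp add: pairing_def lattice_point_def)

lemma lattice_point_in_lattice_points [simp]: "lattice_point u \<in> lattice_points"
  by (simp add: lattice_points_def)

lemma lattice_point_combination:
  "lattice_point p + real_of_int j *\<^sub>R lattice_point f = lattice_point (fst p + j * fst f, snd p + j * snd f)"
  by (simp add: lattice_point_def)

lemma primitive_bezout:
  assumes "primitive f"
  obtains a b where "a * fst f + b * snd f = 1"
  using assms bezout_int[of "fst f" "snd f"] unfolding primitive_def coprime_iff_gcd_eq_1 by auto

lemma primitive_nonzero: "primitive f \<Longrightarrow> lattice_point f \<noteq> 0"
  by (auto simp: primitive_def lattice_point_def prod_eq_iff)

lemma primitive_uminus: "primitive w \<Longrightarrow> primitive (- fst w, - snd w)"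
  by (simp add: primitive_def)

text \<open>
  Orthogonality to \<open>w\<close> makes the two vectors proportional, and a Bezout identity for \<open>f\<close> shows that
  the factor is an integer.
\<close>

lemma integer_kernel:
  assumes w: "primitive w" and f: "primitive f"
    and wf: "fst w * fst f + snd w * snd f = 0" and wx: "fst w * x + snd w * y = 0"
  obtains j where "x = j * fst f" "y = j * snd f"
proof -
  obtain a b where ab: "a * fst f + b * snd f = 1" by (rule primitive_bezout[OF f])
  obtain c d where cd: "c * fst w + d * snd w = 1" by (rule primitive_bezout[OF w])
  have "fst w * (fst f * y - snd f * x) = 0" "snd w * (fst f * y - snd f * x) = 0"
    using wf wx by algebra+
  then have "fst f * y = snd f * x"
    using cd by algebra
  then have "x = (a * x + b * y) * fst f" "y = (a * x + b * y) * snd f"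
    using ab by algebra+
  then show ?thesis by (rule that)
qed

section \<open>Lattice segments\<close>

text \<open>
  With this parametrisation by multiples of a primitive direction, lattice points have integral
  parameters and Minkowski sums of parallel segments add the parameters.
\<close>

lemma closed_segment_ray:
  fixes p f :: "'a::real_vector"
  assumes "0 \<le> k"
  shows "closed_segment p (p + k *\<^sub>R f) = (\<lambda>s. p + s *\<^sub>R f) ` {0..k}"
proof
  show "closed_segment p (p + k *\<^sub>R f) \<subseteq> (\<lambda>s. p + s *\<^sub>R f) ` {0..k}"
  proof
    fix x assume "x \<in> closed_segment p (p + k *\<^sub>R f)"
    then obtain u where "0 \<le> u" "u \<le> 1" "x = (1 - u) *\<^sub>R p + u *\<^sub>R (p + k *\<^sub>R f)"
      by (auto simp: closed_segment_def)
    then show "x \<in> (\<lambda>s. p + s *\<^sub>R f) ` {0..k}"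
      using assms by (intro image_eqI[of _ _ "u * k"]) (auto simp: algebra_simps mult_left_le)
  qed
next
  show "(\<lambda>s. p + s *\<^sub>R f) ` {0..k} \<subseteq> closed_segment p (p + k *\<^sub>R f)"
  proof clarify
    fix s assume s: "s \<in> {0..k}"
    show "p + s *\<^sub>R f \<in> closed_segment p (p + k *\<^sub>R f)"
    proof (cases "k = 0")
      case False
      then have "p + s *\<^sub>R f = (1 - s / k) *\<^sub>R p + (s / k) *\<^sub>R (p + k *\<^sub>R f)"
        by (simp add: algebra_simps)
      moreover have "0 \<le> s / k" "s / k \<le> 1"
        using s False assms by auto
      ultimately show ?thesis
        unfolding closed_segment_def by blast
    qed (use s in auto)
  qed
qed

text \<open>
  If \<open>s f\<close> is integral and \<open>a f\<^sub>1 + b f\<^sub>2 = 1\<close>, then \<open>s = a (s f\<^sub>1) + b (s f\<^sub>2)\<close> is an integer.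
\<close>

lemma width_lattice_segment:
  assumes f: "primitive f"
  shows "width (closed_segment (lattice_point p) (lattice_point p + real k *\<^sub>R lattice_point f)) = k"
proof -
  let ?x = "\<lambda>s. lattice_point p + s *\<^sub>R lattice_point f"
  obtain a b where ab: "a * fst f + b * snd f = 1" by (rule primitive_bezout[OF f])
  have "?x ` {0..real k} \<inter> lattice_points = (\<lambda>j. ?x (real j)) ` {0..k}"
  proof
    show "(\<lambda>j. ?x (real j)) ` {0..k} \<subseteq> ?x ` {0..real k} \<inter> lattice_points"
    proof (rule image_subsetI)
      fix j assume "j \<in> {0..k}"
      moreover have "?x (real j) \<in> lattice_points"
        using lattice_point_combination[of p "int j" f] by simp
      ultimately show "?x (real j) \<in> ?x ` {0..real k} \<inter> lattice_points"
        by auto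
    qed
  next
    show "?x ` {0..real k} \<inter> lattice_points \<subseteq> (\<lambda>j. ?x (real j)) ` {0..k}"
    proof (rule subsetI)
      fix x assume "x \<in> ?x ` {0..real k} \<inter> lattice_points"
      then obtain s q where s: "s \<in> {0..real k}" and x: "x = ?x s" and q: "?x s = lattice_point q"
        by (auto simp: lattice_points_def)
      define j where "j = a * (fst q - fst p) + b * (snd q - snd p)"
      have "s * real_of_int (fst f) = real_of_int (fst q - fst p)"
           "s * real_of_int (snd f) = real_of_int (snd q - snd p)"
        using q by (auto simp: lattice_point_def)
      then have "real_of_int j = a * (s * real_of_int (fst f)) + b * (s * real_of_int (snd f))"
        unfolding j_def by simp
      also have "\<dots> = s * real_of_int (a * fst f + b * snd f)"
        by (simp add: algebra_simps)
      finally have "real_of_int j = s * real_of_int (a * fst f + b * snd f)" .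
      then have "s = real_of_int j"
        using ab by simp
      then have "s = real (nat j)" "nat j \<in> {0..k}"
        using s by auto
      then show "x \<in> (\<lambda>j. ?x (real j)) ` {0..k}"
        unfolding x by (metis imageI)
    qed
  qed
  moreover have "inj_on (\<lambda>j. ?x (real j)) {0..k}"
    using primitive_nonzero[OF f] by (auto simp: inj_on_def)
  ultimately show ?thesis
    by (simp add: width_def closed_segment_ray card_image)
qed

text \<open>
  The lattice points that span \<open>S\<close> differ by integral multiples of \<open>f\<close>, so the two extreme ones
  already span it.
\<close>

lemma lattice_polytope_on_line:
  assumes w: "primitive w" and f: "primitive f" and wf: "pairing w (lattice_point f) = 0"
    and S: "lattice_polytope S" "S \<noteq> {}" and line: "\<And>x. x \<in> S \<Longrightarrow> pairing w x = h"
  obtains p k where "S = closed_segment (lattice_point p) (lattice_point p + real k *\<^sub>R lattice_point f)"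
proof -
  obtain V where V: "finite V" "V \<subseteq> lattice_points" "S = convex hull V"
    using S by (auto simp: lattice_polytope_def)
  then have "V \<noteq> {}" and VS: "V \<subseteq> S" using S by (auto simp: hull_subset)
  then obtain v where "v \<in> V" by blast
  then obtain q where q: "lattice_point q \<in> V" using V by (auto simp: lattice_points_def)
  let ?x = "\<lambda>j. lattice_point q + real_of_int j *\<^sub>R lattice_point f"
  have "\<exists>j. v = ?x j" if v: "v \<in> V" for v
  proof -
    obtain u where u: "v = lattice_point u" using v V by (auto simp: lattice_points_def)
    have "pairing w (lattice_point u) = pairing w (lattice_point q)"
      using v q VS line u by (metis subsetD)
    then have "fst w * (fst u - fst q) + snd w * (snd u - snd q) = 0"
      unfolding pairing_lattice_point of_int_eq_iff by (simp add: algebra_simps)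
    moreover have "fst w * fst f + snd w * snd f = 0"
      using wf unfolding pairing_lattice_point of_int_eq_0_iff .
    ultimately obtain j where "fst u - fst q = j * fst f" "snd u - snd q = j * snd f"
      by (metis integer_kernel[OF w f])
    then have "u = (fst q + j * fst f, snd q + j * snd f)" by (simp add: prod_eq_iff)
    then show ?thesis using u by (auto simp: lattice_point_combination)
  qed
  then obtain J where J: "\<And>v. v \<in> V \<Longrightarrow> v = ?x (J v)" by metis
  define lo hi where "lo = Min (J ` V)" and "hi = Max (J ` V)"
  have bounds: "lo \<le> J v" "J v \<le> hi" if "v \<in> V" for v
    using that V by (auto simp: lo_def hi_def)
  then have "lo \<le> hi" using q by (meson order_trans)
  have ends: "?x lo \<in> V" "?x hi \<in> V"
  proof -
    have "lo \<in> J ` V" "hi \<in> J ` V"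
      using V \<open>V \<noteq> {}\<close> by (auto simp: lo_def hi_def)
    then show "?x lo \<in> V" "?x hi \<in> V" using J by (metis imageE)+
  qed
  have seg: "closed_segment (?x lo) (?x hi) = (\<lambda>s. ?x lo + s *\<^sub>R lattice_point f) ` {0..real (nat (hi - lo))}"
    using closed_segment_ray[of "real (nat (hi - lo))" "?x lo" "lattice_point f"] \<open>lo \<le> hi\<close>
    by (simp add: algebra_simps)
  have "S = closed_segment (?x lo) (?x hi)"
  proof
    have "V \<subseteq> closed_segment (?x lo) (?x hi)"
    proof
      fix v assume v: "v \<in> V"
      have "v = ?x lo + real_of_int (J v - lo) *\<^sub>R lattice_point f"
        using J[OF v] by (simp add: algebra_simps)
      then show "v \<in> closed_segment (?x lo) (?x hi)"
        unfolding seg using bounds[OF v] by (intro image_eqI) auto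
    qed
    then show "S \<subseteq> closed_segment (?x lo) (?x hi)"
      unfolding V by (intro hull_minimal) auto
  next
    show "closed_segment (?x lo) (?x hi) \<subseteq> S"
      unfolding V segment_convex_hull using ends by (intro hull_mono) auto
  qed
  also have "\<dots> = closed_segment (?x lo) (?x lo + real (nat (hi - lo)) *\<^sub>R lattice_point f)"
    using \<open>lo \<le> hi\<close> by (simp add: algebra_simps)
  finally show ?thesis
    unfolding lattice_point_combination by (rule that)
qed

lemma dilate_primitive_segment:
  assumes "0 \<le> r"
  shows "dilate r (convex hull {0, f}) = (\<lambda>s. s *\<^sub>R f) ` {0..real_of_int r}"
proof -
  have "convex hull {0, f} = (\<lambda>s. s *\<^sub>R f) ` {0..1}"
    using closed_segment_ray[of 1 0 f] by (simp add: segment_convex_hull)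
  then have "dilate r (convex hull {0, f}) = (\<lambda>s. s *\<^sub>R f) ` ((*) (real_of_int r) ` {0..1})"
    by (simp add: dilate_def image_image)
  also have "(*) (real_of_int r) ` {0..1} = {0..real_of_int r}"
    using assms image_mult_atLeastAtMost_if[of "real_of_int r" 0 1] by auto
  finally show ?thesis .
qed

text \<open>
  This additivity is the source of the change of width under mutation of the two faces parallel
  to \<open>f\<close>.
\<close>

lemma width_plus_dilated_segment:
  assumes w: "primitive w" and f: "primitive f" and wf: "pairing w (lattice_point f) = 0"
    and S: "lattice_polytope S" "S \<noteq> {}" and line: "\<And>x. x \<in> S \<Longrightarrow> pairing w x = h"
    and r: "0 \<le> r"
  shows "width (S + dilate r (convex hull {0, lattice_point f})) = width S + nat r"
proof -
  obtain p k where S_eq: "S = closed_segment (lattice_point p) (lattice_point p + real k *\<^sub>R lattice_point f)"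
    using lattice_polytope_on_line[OF assms(1-6)] by metis
  have "S + dilate r (convex hull {0, lattice_point f}) =
        (\<lambda>s. lattice_point p + s *\<^sub>R lattice_point f) ` {0..real (k + nat r)}" (is "?L = ?R")
  proof
    show "?L \<subseteq> ?R"
      unfolding S_eq dilate_primitive_segment[OF r]
    proof (rule subsetI)
      fix x
      assume "x \<in> closed_segment (lattice_point p) (lattice_point p + real k *\<^sub>R lattice_point f)
                   + (\<lambda>s. s *\<^sub>R lattice_point f) ` {0..real_of_int r}"
      then obtain s t where "0 \<le> s" "s \<le> real k" "0 \<le> t" "t \<le> real_of_int r"
        and x: "x = (lattice_point p + s *\<^sub>R lattice_point f) + t *\<^sub>R lattice_point f"
        by (auto simp: closed_segment_ray set_plus_def)
      then show "x \<in> ?R"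
        by (intro image_eqI[of _ _ "s + t"]) (auto simp: algebra_simps)
    qed
    show "?R \<subseteq> ?L"
    proof (rule image_subsetI)
      fix s assume s: "s \<in> {0..real (k + nat r)}"
      have "lattice_point p + min s (real k) *\<^sub>R lattice_point f \<in> S"
        unfolding S_eq closed_segment_ray[OF of_nat_0_le_iff] using s by auto
      moreover have "(s - min s (real k)) *\<^sub>R lattice_point f \<in> dilate r (convex hull {0, lattice_point f})"
        unfolding dilate_primitive_segment[OF r] using s r by (intro imageI) auto
      ultimately have "(lattice_point p + min s (real k) *\<^sub>R lattice_point f) + (s - min s (real k)) *\<^sub>R lattice_point f \<in> ?L"
        by (rule set_plus_intro)
      then show "lattice_point p + s *\<^sub>R lattice_point f \<in> ?L"
        by (simp add: algebra_simps)
    qed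
  qed
  also have "\<dots> = closed_segment (lattice_point p) (lattice_point p + real (k + nat r) *\<^sub>R lattice_point f)"
    by (simp add: closed_segment_ray)
  finally show ?thesis
    unfolding S_eq by (simp only: width_lattice_segment[OF f])
qed

section \<open>Faces where a functional is minimal\<close>

definition bottom_face :: "real \<times> real \<Rightarrow> (real \<times> real) set \<Rightarrow> (real \<times> real) set" where
  "bottom_face a P = {x \<in> P. \<forall>y\<in>P. a \<bullet> x \<le> a \<bullet> y}"

lemma bottom_face_level:
  "x \<in> bottom_face a P \<Longrightarrow> bottom_face a P = {y \<in> P. a \<bullet> y = a \<bullet> x}"
  by (force simp: bottom_face_def)

lemma convex_hull_lower_bound:
  assumes "\<And>x. x \<in> U \<Longrightarrow> m \<le> a \<bullet> x" "x \<in> convex hull U"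
  shows "m \<le> a \<bullet> x"
proof -
  have "convex hull U \<subseteq> {x. a \<bullet> x \<ge> m}"
    using assms(1) by (intro hull_minimal) (auto simp: convex_halfspace_ge)
  then show ?thesis using assms(2) by auto
qed

text \<open>
  The hull of the points at level \<open>m\<close>, together with the open half-space above that level, is still
  convex. It contains \<open>U\<close>, hence the hull of \<open>U\<close>.
\<close>

lemma convex_hull_minimal_level:
  fixes a :: "'a::real_inner"
  assumes "\<And>x. x \<in> U \<Longrightarrow> m \<le> a \<bullet> x"
  shows "{x \<in> convex hull U. a \<bullet> x = m} = convex hull {x \<in> U. a \<bullet> x = m}"
proof
  let ?K = "convex hull {x \<in> U. a \<bullet> x = m}"
  have K: "?K \<subseteq> {x. a \<bullet> x = m}"
    by (intro hull_minimal) (auto simp: convex_hyperplane)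
  have "convex (?K \<union> {x. a \<bullet> x > m})"
  proof (rule convexI)
    fix x y and s t :: real
    assume xy: "x \<in> ?K \<union> {x. a \<bullet> x > m}" "y \<in> ?K \<union> {x. a \<bullet> x > m}"
      and st: "0 \<le> s" "0 \<le> t" "s + t = 1"
    consider "s = 0" | "t = 0" | "0 < s" "0 < t" using st by linarith
    then show "s *\<^sub>R x + t *\<^sub>R y \<in> ?K \<union> {x. a \<bullet> x > m}"
    proof cases
      case 3
      show ?thesis
      proof (cases "x \<in> ?K \<and> y \<in> ?K")
        case True
        then show ?thesis using convexD[OF convex_convex_hull] st by blast
      next
        case False
        then have "m < a \<bullet> x \<and> m \<le> a \<bullet> y \<or> m \<le> a \<bullet> x \<and> m < a \<bullet> y"
          using xy K by fastforce
        then have "s * m + t * m < s * (a \<bullet> x) + t * (a \<bullet> y)"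
          using 3 by (smt (verit) mult_left_mono mult_strict_left_mono)
        moreover have "s * m + t * m = m" using st by (metis distrib_right mult_1)
        ultimately show ?thesis by (simp add: inner_add_right)
      qed
    qed (use xy st in auto)
  qed
  moreover have "U \<subseteq> ?K \<union> {x. a \<bullet> x > m}"
  proof
    fix x assume "x \<in> U"
    then show "x \<in> ?K \<union> {x. a \<bullet> x > m}"
      using assms[of x] by (cases "a \<bullet> x = m") (auto intro: hull_inc)
  qed
  ultimately have "convex hull U \<subseteq> ?K \<union> {x. a \<bullet> x > m}"
    by (rule hull_minimal[rotated])
  then show "{x \<in> convex hull U. a \<bullet> x = m} \<subseteq> ?K" by auto
  show "?K \<subseteq> {x \<in> convex hull U. a \<bullet> x = m}"
    using K hull_mono[of "{x \<in> U. a \<bullet> x = m}" U convex] by auto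
qed

lemma lattice_polytope_imp_polytope: "lattice_polytope P \<Longrightarrow> polytope P"
  by (auto simp: lattice_polytope_def polytope_def)

lemma hull_vertices_eq:
  fixes P :: "'a::euclidean_space set"
  assumes "polytope P" shows "convex hull {x. x extreme_point_of P} = P"
  using Krein_Milman_Minkowski[OF polytope_imp_compact[OF assms] polytope_imp_convex[OF assms]] by (rule sym)

lemma finite_vertices:
  fixes P :: "'a::euclidean_space set"
  assumes "polytope P" shows "finite {x. x extreme_point_of P}"
  using assms finite_polyhedron_extreme_points polytope_imp_polyhedron by blast

lemma lattice_polytope_vertex:
  assumes "lattice_polytope P" "x extreme_point_of P"
  obtains u where "x = lattice_point u"
proof -
  obtain V where "V \<subseteq> lattice_points" "P = convex hull V"
    using assms(1) by (auto simp: lattice_polytope_def)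
  then have "x \<in> lattice_points"
    using assms(2) extreme_point_of_convex_hull by blast
  then show ?thesis
    using that by (auto simp: lattice_points_def)
qed

lemma minimizing_vertex:
  assumes "polytope P" "P \<noteq> {}"
  obtains x where "x extreme_point_of P" "x \<in> bottom_face a P"
proof -
  let ?V = "{x. x extreme_point_of P}"
  have "?V \<noteq> {}"
    using hull_vertices_eq[OF assms(1)] assms(2) by (metis convex_hull_empty)
  then obtain x where x: "x \<in> ?V" "\<And>y. y \<in> ?V \<Longrightarrow> a \<bullet> x \<le> a \<bullet> y"
    using arg_min_if_finite[OF finite_vertices[OF assms(1)], of "\<lambda>x. a \<bullet> x"]
    by (metis (no_types, lifting) linorder_not_less)
  have "a \<bullet> x \<le> a \<bullet> y" if "y \<in> P" for y
    using convex_hull_lower_bound[of ?V "a \<bullet> x" a y] x(2) that hull_vertices_eq[OF assms(1)] by simp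
  then show ?thesis
    using that x by (auto simp: bottom_face_def extreme_point_of_def)
qed

lemma bottom_face_eq_hull_vertices:
  assumes "polytope P"
  shows "bottom_face a P = convex hull {x. x extreme_point_of P \<and> x \<in> bottom_face a P}"
proof (cases "P = {}")
  case False
  let ?V = "{x. x extreme_point_of P}"
  obtain x where x: "x extreme_point_of P" "x \<in> bottom_face a P"
    by (rule minimizing_vertex[OF assms False])
  have VP: "y \<in> P" if "y extreme_point_of P" for y using that by (simp add: extreme_point_of_def)
  have "bottom_face a P = {y \<in> convex hull ?V. a \<bullet> y = a \<bullet> x}"
    using bottom_face_level[OF x(2)] hull_vertices_eq[OF assms] by simp
  also have "\<dots> = convex hull {y \<in> ?V. a \<bullet> y = a \<bullet> x}"
    using x(2) VP by (intro convex_hull_minimal_level) (auto simp: bottom_face_def)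
  also have "{y \<in> ?V. a \<bullet> y = a \<bullet> x} = {y. y extreme_point_of P \<and> y \<in> bottom_face a P}"
    using bottom_face_level[OF x(2)] VP by auto
  finally show ?thesis .
qed (simp add: bottom_face_def)

lemma lattice_polytope_bottom_face:
  assumes "lattice_polytope P" shows "lattice_polytope (bottom_face a P)"
proof -
  have "finite {x. x extreme_point_of P \<and> x \<in> bottom_face a P}"
    by (rule finite_subset[OF _ finite_vertices[OF lattice_polytope_imp_polytope[OF assms]]]) auto
  moreover have "{x. x extreme_point_of P \<and> x \<in> bottom_face a P} \<subseteq> lattice_points"
    using lattice_polytope_vertex[OF assms] by (metis (no_types, lifting) lattice_point_in_lattice_points mem_Collect_eq subsetI)
  ultimately show ?thesis
    using bottom_face_eq_hull_vertices[OF lattice_polytope_imp_polytope[OF assms]]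
    unfolding lattice_polytope_def by blast
qed

lemma negative_direction:
  fixes a :: "real \<times> real"
  assumes "0 \<in> interior P" "a \<noteq> 0"
  obtains y where "y \<in> P" "a \<bullet> y < 0"
proof -
  obtain e where e: "e > 0" "cball 0 e \<subseteq> P"
    using assms(1) by (meson mem_interior_cball)
  let ?y = "- (e / norm a) *\<^sub>R a"
  have "?y \<in> P" using e assms(2) by (intro subsetD[OF e(2)]) auto
  moreover have "a \<bullet> ?y < 0"
    using e assms(2) by simp
  ultimately show ?thesis by (rule that)
qed

definition height :: "int \<times> int \<Rightarrow> (real \<times> real) set \<Rightarrow> nat" where
  "height u P = nat \<lfloor>- min_level u P\<rfloor>"

text \<open>
  The value at \<open>u\<close> does not presuppose that \<open>u\<close> is the normal of an edge: a vertex has width \<open>0\<close>.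
  This covers edges that appear or disappear under mutation.
\<close>

definition T_number :: "(real \<times> real) set \<Rightarrow> int \<times> int \<Rightarrow> nat" where
  "T_number P u = width (bottom_face (lattice_point u) P) div height u P"

lemma min_level_eq:
  assumes "x \<in> bottom_face (lattice_point u) P"
  shows "min_level u P = pairing u x"
  unfolding min_level_def using assms
  by (intro cInf_eq_minimum) (auto simp: bottom_face_def pairing_eq_inner)

text \<open>
  The minimum of \<open>u\<close> is attained at a lattice point, so it is an integer, and it is negative because
  the origin is an interior point.
\<close>

lemma height_facts:
  assumes P: "lattice_polytope P" "0 \<in> interior P" and u: "primitive u"
  shows "min_level u P = - real (height u P)" "height u P > 0"
    "bottom_face (lattice_point u) P = {x \<in> P. pairing u x = - real (height u P)}"
    "bottom_face (lattice_point u) P \<noteq> {}"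
    "\<And>y. y \<in> P \<Longrightarrow> - real (height u P) \<le> pairing u y"
proof -
  have "P \<noteq> {}" using P(2) interior_subset by blast
  then obtain x where x: "x extreme_point_of P" "x \<in> bottom_face (lattice_point u) P"
    using minimizing_vertex lattice_polytope_imp_polytope[OF P(1)] by metis
  obtain v where v: "x = lattice_point v"
    using lattice_polytope_vertex[OF P(1) x(1)] .
  obtain y where y: "y \<in> P" "pairing u y < 0"
    using negative_direction[OF P(2) primitive_nonzero[OF u]] unfolding pairing_eq_inner by metis
  have neg: "pairing u x < 0"
    using x(2) y by (fastforce simp: bottom_face_def pairing_eq_inner)
  have ml: "min_level u P = pairing u x" by (rule min_level_eq[OF x(2)])
  then have h: "pairing u x = - real (height u P)"
    using neg unfolding height_def ml unfolding v pairing_lattice_point by simp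
  show "min_level u P = - real (height u P)" using ml h by simp
  show "height u P > 0" using neg h by simp
  show "bottom_face (lattice_point u) P = {x \<in> P. pairing u x = - real (height u P)}"
    using bottom_face_level[OF x(2)] h by (simp add: pairing_eq_inner)
  show "bottom_face (lattice_point u) P \<noteq> {}" using x by auto
  show "- real (height u P) \<le> pairing u y" if "y \<in> P" for y
    using x(2) that h by (auto simp: bottom_face_def pairing_eq_inner)
qed

section \<open>Edges and primitive T-cones\<close>

text \<open>
  Distinct points on a line that avoids the origin are linearly independent, so they determine the
  functional \<open>u / r = v / s\<close>. Primitivity then leaves only a sign, which the signs of \<open>r\<close> and \<open>s\<close>
  decide.
\<close>

lemma inner_normal_unique:
  assumes u: "primitive u" and v: "primitive v" and "p \<noteq> q"
    and up: "pairing u p = - r" and uq: "pairing u q = - r"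
    and vp: "pairing v p = - s" and vq: "pairing v q = - s" and "r > 0" "s > 0"
  shows "u = v"
proof -
  obtain a b where ab: "a * fst u + b * snd u = 1" by (rule primitive_bezout[OF u])
  obtain c d where cd: "c * fst v + d * snd v = 1" by (rule primitive_bezout[OF v])
  define D where "D = fst p * snd q - snd p * fst q"
  \<comment> \<open>Cramer's rule for the system saying that \<open>u\<close> has value \<open>- r\<close> at \<open>p\<close> and \<open>q\<close>\<close>
  have uD: "fst u * D = r * (snd p - snd q)" "snd u * D = r * (fst q - fst p)"
    using up uq unfolding D_def pairing_def by algebra+
  have vD: "fst v * D = s * (snd p - snd q)" "snd v * D = s * (fst q - fst p)"
    using vp vq unfolding D_def pairing_def by algebra+
  have "D \<noteq> 0"
    using uD \<open>p \<noteq> q\<close> \<open>r > 0\<close> by (auto simp: prod_eq_iff)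
  moreover have "(s * fst u) * D = (r * fst v) * D" "(s * snd u) * D = (r * snd v) * D"
    using uD vD by algebra+
  ultimately have scaled: "s * fst u = r * fst v" "s * snd u = r * snd v"
    by auto
  define m where "m = a * fst v + b * snd v"
  have "s = s * real_of_int (a * fst u + b * snd u)" using ab by simp
  also have "\<dots> = a * (s * fst u) + b * (s * snd u)" by (simp add: algebra_simps)
  also have "\<dots> = r * m" unfolding scaled m_def by (simp add: algebra_simps)
  finally have s: "s = r * m" .
  then have "m > 0"
    using \<open>r > 0\<close> \<open>s > 0\<close> by (simp add: zero_less_mult_iff)
  have "r * (m * fst u) = r * fst v" "r * (m * snd u) = r * snd v"
    using scaled unfolding s by simp_all
  then have "real_of_int (m * fst u) = fst v" "real_of_int (m * snd u) = snd v"
    using \<open>r > 0\<close> by simp_all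
  then have mv: "m * fst u = fst v" "m * snd u = snd v"
    unfolding of_int_eq_iff by simp_all
  have "m * (c * fst u + d * snd u) = 1"
    using cd unfolding mv[symmetric] by (simp add: algebra_simps)
  then have "m = 1"
    using \<open>m > 0\<close> by (metis int_one_le_iff_zero_less pos_zmult_eq_1_iff)
  then show ?thesis
    using mv by (simp add: prod_eq_iff)
qed

lemma primitive_direction:
  fixes d :: "int \<times> int"
  assumes "d \<noteq> (0, 0)"
  obtains f g where "primitive f" "g > 0" "fst d = g * fst f" "snd d = g * snd f"
proof -
  let ?g = "gcd (fst d) (snd d)"
  have "?g \<noteq> 0" using assms by (auto simp: prod_eq_iff)
  then obtain a b where "fst d = a * ?g" "snd d = b * ?g" "coprime a b"
    using gcd_coprime_exists by blast
  moreover have "?g > 0" using \<open>?g \<noteq> 0\<close> gcd_ge_0_int[of "fst d" "snd d"] by linarith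
  ultimately show ?thesis
    using that[of "(a, b)" ?g] by (simp add: primitive_def mult.commute)
qed

lemma aff_dim_one_two_points:
  assumes "aff_dim E = 1"
  obtains p q where "p \<in> E" "q \<in> E" "p \<noteq> q"
proof -
  have "\<not> (\<exists>p. E \<subseteq> {p})"
    using assms by (auto simp: subset_singleton_iff)
  then show ?thesis using that by blast
qed

text \<open>
  This class of polygons is shown below to be closed under mutation, so that the count of T-cones
  applies to both polygons.
\<close>

locale lattice_polygon =
  fixes P :: "(real \<times> real) set"
  assumes lattice: "lattice_polytope P"
    and origin: "0 \<in> interior P"
begin

lemmas height_props = height_facts[OF lattice origin]

lemma convex_P: "convex P"
  using lattice by (simp add: lattice_polytope_imp_polytope polytope_imp_convex)

text \<open>
  The vertices of an edge are vertices of the polygon, hence lattice points.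
\<close>

lemma edge_two_lattice_points:
  assumes "E edge_of P"
  obtains p q where "lattice_point p \<in> E" "lattice_point q \<in> E" "p \<noteq> q"
proof -
  have E: "E face_of P" "aff_dim E = 1" using assms by (auto simp: edge_of_def)
  have poly: "polytope P" using lattice by (rule lattice_polytope_imp_polytope)
  then have "polytope E" using E(1) face_of_polytope_polytope by blast
  then have hull: "convex hull {x. x extreme_point_of E} = E" by (rule hull_vertices_eq)
  then have "aff_dim {x. x extreme_point_of E} = 1"
    using E(2) by (metis aff_dim_convex_hull)
  then obtain x y where xy: "x extreme_point_of E" "y extreme_point_of E" "x \<noteq> y"
    using aff_dim_one_two_points by (metis mem_Collect_eq)
  then have "x extreme_point_of P" "y extreme_point_of P" "x \<in> E" "y \<in> E"
    using extreme_point_of_face[OF E(1)] by auto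
  then show ?thesis
    using that xy lattice_polytope_vertex[OF lattice] by metis
qed

text \<open>
  Faces of polytopes are exposed, a priori by a real functional. It is not zero, because \<open>P\<close>
  is two-dimensional, and it vanishes on the direction between two lattice points of the edge; so it is a multiple of a
  primitive integral one.
\<close>

lemma edge_is_bottom_face:
  assumes "E edge_of P"
  obtains u where "primitive u" "E = bottom_face (lattice_point u) P"
proof -
  obtain p q where pq: "lattice_point p \<in> E" "lattice_point q \<in> E" "p \<noteq> q"
    by (rule edge_two_lattice_points[OF assms])
  have "E exposed_face_of P"
    using assms lattice exposed_face_of_polyhedron polytope_imp_polyhedron lattice_polytope_imp_polytope
    unfolding edge_of_def by metis
  then obtain a b where ab: "P \<subseteq> {x. a \<bullet> x \<le> b}" "E = P \<inter> {x. a \<bullet> x = b}"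
    by (auto simp: exposed_face_of_def)
  have "a \<noteq> 0"
  proof
    assume "a = 0"
    then have "E = P" using ab pq by auto
    moreover have "aff_dim P = 2"
      using aff_dim_nonempty_interior[of P] origin by auto
    ultimately show False using assms by (simp add: edge_of_def)
  qed
  have "(fst q - fst p, snd q - snd p) \<noteq> (0, 0)"
    using pq(3) by (auto simp: prod_eq_iff)
  then obtain f g where f: "primitive f" "g > 0" "fst q - fst p = g * fst f" "snd q - snd p = g * snd f"
    using primitive_direction[of "(fst q - fst p, snd q - snd p)"] by (metis fst_conv snd_conv)
  have "a \<bullet> lattice_point p = a \<bullet> lattice_point q" using ab pq by auto
  then have "fst a * real_of_int (fst q - fst p) + snd a * real_of_int (snd q - snd p) = 0"
    by (simp add: inner_prod_def lattice_point_def algebra_simps)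
  then have "real_of_int g * (fst a * fst f + snd a * snd f) = 0"
    unfolding f by (simp add: algebra_simps)
  then have af: "fst a * fst f + snd a * snd f = 0"
    using f(2) by simp
  obtain c d where cd: "c * fst f + d * snd f = 1" by (rule primitive_bezout[OF f(1)])
  then have cdr: "real_of_int c * fst f + real_of_int d * snd f = 1"
    by (metis of_int_1 of_int_add of_int_mult)
  \<comment> \<open>the factor with \<open>a = t (f\<^sub>2, - f\<^sub>1)\<close>, computed from the Bezout identity for \<open>f\<close>\<close>
  define t where "t = real_of_int d * fst a - real_of_int c * snd a"
  have a: "fst a = t * snd f" "snd a = - t * fst f"
    using af cdr unfolding t_def by algebra+
  have "t \<noteq> 0" using a \<open>a \<noteq> 0\<close> by (auto simp: prod_eq_iff)
  define u where "u = (if t < 0 then (snd f, - fst f) else (- snd f, fst f))"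
  have u: "primitive u"
    using f(1) by (auto simp: u_def primitive_def coprime_commute)
  have au: "- a = \<bar>t\<bar> *\<^sub>R lattice_point u"
    using a by (auto simp: u_def lattice_point_def prod_eq_iff)
  have "a \<bullet> y \<le> a \<bullet> x \<longleftrightarrow> lattice_point u \<bullet> x \<le> lattice_point u \<bullet> y" for x y
  proof -
    have "a \<bullet> y \<le> a \<bullet> x \<longleftrightarrow> (- a) \<bullet> x \<le> (- a) \<bullet> y" by simp
    also have "\<dots> \<longleftrightarrow> lattice_point u \<bullet> x \<le> lattice_point u \<bullet> y"
      unfolding au using \<open>t \<noteq> 0\<close> by simp
    finally show ?thesis .
  qed
  then have "bottom_face (lattice_point u) P = {x \<in> P. \<forall>y\<in>P. a \<bullet> y \<le> a \<bullet> x}"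
    by (simp add: bottom_face_def)
  also have "\<dots> = E"
    using ab pq(1) by (auto intro: antisym)
  finally show ?thesis using that u by blast
qed

lemma bottom_face_is_edge:
  assumes u: "primitive u" and "width (bottom_face (lattice_point u) P) \<noteq> 0"
  shows "bottom_face (lattice_point u) P edge_of P"
proof -
  let ?E = "bottom_face (lattice_point u) P"
  let ?f = "(- snd u, fst u)"
  have f: "primitive ?f" "pairing u (lattice_point ?f) = 0"
    using u by (auto simp: primitive_def pairing_lattice_point coprime_commute)
  have level: "pairing u x = - real (height u P)" if "x \<in> ?E" for x
    using that height_props(3)[OF u] by auto
  obtain p k where E: "?E = closed_segment (lattice_point p) (lattice_point p + real k *\<^sub>R lattice_point ?f)"
    using lattice_polytope_on_line[OF u f lattice_polytope_bottom_face[OF lattice] height_props(4)[OF u] level] .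
  then have "k \<noteq> 0" using assms(2) width_lattice_segment[OF f(1)] by metis
  then have "aff_dim ?E = 1"
    unfolding E segment_convex_hull aff_dim_convex_hull using primitive_nonzero[OF f(1)] by simp
  moreover have "?E = P \<inter> {x. lattice_point u \<bullet> x = - real (height u P)}"
    using height_props(3)[OF u] by (auto simp: pairing_eq_inner)
  then have "?E face_of P"
    using height_props(5)[OF u] face_of_Int_supporting_hyperplane_ge[OF convex_P]
    by (simp add: pairing_eq_inner)
  ultimately show ?thesis by (simp add: edge_of_def)
qed

lemma bottom_face_normal_unique:
  assumes "primitive u" "primitive v" "p \<noteq> q"
    and "p \<in> bottom_face (lattice_point u) P" "q \<in> bottom_face (lattice_point u) P"
    and "p \<in> bottom_face (lattice_point v) P" "q \<in> bottom_face (lattice_point v) P"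
  shows "u = v"
  using inner_normal_unique[OF assms(1-3), of "real (height u P)" "real (height v P)"] assms(4-7)
    height_props(2,3)[OF assms(1)] height_props(2,3)[OF assms(2)] by simp

lemma inner_normal_bottom_face:
  assumes u: "primitive u" and E: "bottom_face (lattice_point u) P edge_of P" (is "?E edge_of P")
  shows "inner_normal P ?E = u"
  unfolding inner_normal_def
proof (rule the_equality)
  show "is_inner_normal P ?E u"
    unfolding is_inner_normal_def using u height_props(3,5)[OF u] by blast
next
  fix v assume "is_inner_normal P ?E v"
  then obtain h where v: "primitive v" and h: "?E = {x \<in> P. pairing v x = h}" "\<And>x. x \<in> P \<Longrightarrow> h \<le> pairing v x"
    by (auto simp: is_inner_normal_def)
  obtain p q where pq: "p \<in> ?E" "q \<in> ?E" "p \<noteq> q"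
    using aff_dim_one_two_points E by (metis edge_of_def)
  have "x \<in> bottom_face (lattice_point v) P" if "x \<in> ?E" for x
    using that h unfolding h(1) bottom_face_def pairing_eq_inner by auto
  then show "v = u"
    using bottom_face_normal_unique[OF v u pq(3)] pq by blast
qed

lemma edge_facts:
  assumes "E edge_of P"
  shows "primitive (inner_normal P E)"
    and "E = bottom_face (lattice_point (inner_normal P E)) P"
    and "edge_height P E = height (inner_normal P E) P"
proof -
  obtain u where u: "primitive u" "E = bottom_face (lattice_point u) P"
    by (rule edge_is_bottom_face[OF assms])
  then have n: "inner_normal P E = u"
    using inner_normal_bottom_face assms by blast
  show "primitive (inner_normal P E)" "E = bottom_face (lattice_point (inner_normal P E)) P"
    using u n by auto
  have "pairing u ` E = {- real (height u P)}"
    using height_props(3,4)[OF u(1)] unfolding u(2) by auto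
  then show "edge_height P E = height (inner_normal P E) P"
    unfolding edge_height_def n by auto
qed

lemma edge_unique:
  assumes "E edge_of P" "E' edge_of P" "p \<noteq> q" "p \<in> E" "q \<in> E" "p \<in> E'" "q \<in> E'"
  shows "E = E'"
  using bottom_face_normal_unique[OF edge_facts(1)[OF assms(1)] edge_facts(1)[OF assms(2)] assms(3)]
    edge_facts(2)[OF assms(1)] edge_facts(2)[OF assms(2)] assms(4-) by metis

lemma pairing_edge:
  assumes "E edge_of P" "x \<in> E"
  shows "pairing (inner_normal P E) x = - real (edge_height P E)"
  using assms edge_facts[OF assms(1)] height_props(3)[OF edge_facts(1)[OF assms(1)]] by auto

lemma pairing_edge_ge:
  assumes "E edge_of P" "x \<in> P"
  shows "- real (edge_height P E) \<le> pairing (inner_normal P E) x"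
  using assms edge_facts[OF assms(1)] height_props(5)[OF edge_facts(1)[OF assms(1)]] by auto

lemma edge_height_pos: "E edge_of P \<Longrightarrow> edge_height P E > 0"
  using edge_facts(1,3) height_props(2) by simp

text \<open>
  The segment can be read off from its cone, so different segments of a subdivision give different
  T-cones.
\<close>

lemma conic_hull_slice:
  assumes E: "E edge_of P" and "S \<subseteq> E"
  shows "{x \<in> conic hull S. pairing (inner_normal P E) x = - real (edge_height P E)} = S"
proof
  show "S \<subseteq> {x \<in> conic hull S. pairing (inner_normal P E) x = - real (edge_height P E)}"
    using assms pairing_edge[OF E] by (auto intro: hull_inc)
next
  show "{x \<in> conic hull S. pairing (inner_normal P E) x = - real (edge_height P E)} \<subseteq> S"
  proof
    fix x assume "x \<in> {x \<in> conic hull S. pairing (inner_normal P E) x = - real (edge_height P E)}"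
    then obtain c s where x: "x = c *\<^sub>R s" "s \<in> S" "pairing (inner_normal P E) (c *\<^sub>R s) = - real (edge_height P E)"
      by (auto simp: conic_hull_explicit)
    then have "c * real (edge_height P E) = real (edge_height P E)"
      using pairing_edge[OF E, of s] \<open>S \<subseteq> E\<close> by (auto simp: pairing_eq_inner)
    then have "c = 1" using edge_height_pos[OF E] by simp
    then show "x \<in> S" using x by simp
  qed
qed

text \<open>
  If \<open>s \<in> E\<close> and \<open>s = c e\<close> with \<open>e \<in> E'\<close>, then the normal of \<open>E\<close> forces \<open>c \<ge> 1\<close>, since \<open>e\<close> does not
  lie below the level of \<open>E\<close>, and symmetrically the normal of \<open>E'\<close> forces \<open>c \<le> 1\<close>.
\<close>

lemma subset_edge_of_conic_hull:
  assumes E: "E edge_of P" "S \<subseteq> E" and E': "E' edge_of P" and sub: "conic hull S \<subseteq> conic hull E'"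
  shows "S \<subseteq> E'"
proof
  fix s assume s: "s \<in> S"
  then have "s \<in> conic hull E'" using sub by (auto intro: hull_inc)
  then obtain c e where c: "s = c *\<^sub>R e" "e \<in> E'" "0 \<le> c"
    by (auto simp: conic_hull_explicit)
  have "s \<in> P" "e \<in> P"
    using s c E E' edge_of_imp_subset by blast+
  have "- (c * real (edge_height P E)) \<le> c * pairing (inner_normal P E) e"
    using mult_left_mono[OF pairing_edge_ge[OF E(1) \<open>e \<in> P\<close>] c(3)] by simp
  moreover have "c * pairing (inner_normal P E) e = - real (edge_height P E)"
    using pairing_edge[OF E(1), of s] E(2) s c(1) by (auto simp: pairing_eq_inner)
  ultimately have "c \<ge> 1"
    using edge_height_pos[OF E(1)] by simp
  have "- real (edge_height P E') \<le> c * pairing (inner_normal P E') e"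
    using pairing_edge_ge[OF E' \<open>s \<in> P\<close>] c(1) by (simp add: pairing_eq_inner)
  then have "c \<le> 1"
    using pairing_edge[OF E' c(2)] edge_height_pos[OF E'] by simp
  then show "s \<in> E'"
    using \<open>c \<ge> 1\<close> c by simp
qed

lemma cone_edge_conic_hull:
  assumes E: "E edge_of P" "S \<subseteq> E" and S: "lattice_segment S"
  shows "cone_edge P (conic hull S) = E"
  unfolding cone_edge_def
proof (rule the_equality)
  show "E edge_of P \<and> conic hull S \<subseteq> conic hull E"
    using E hull_mono by blast
next
  fix E' assume E': "E' edge_of P \<and> conic hull S \<subseteq> conic hull E'"
  obtain a b where "a \<noteq> b" "a \<in> S" "b \<in> S"
    using S by (auto simp: lattice_segment_def)
  then show "E' = E"
    using edge_unique[of E E' a b] subset_edge_of_conic_hull[OF E] E E' by blast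
qed

context
  fixes \<sigma> assumes sub: "polygon_subdivision P \<sigma>"
begin

lemma subdivision_segment:
  assumes "E edge_of P" "S \<in> \<sigma> E"
  shows "S \<subseteq> E" "lattice_segment S"
  using assms sub by (auto simp: polygon_subdivision_def edge_subdivision_def)

lemma cone_normal_conic_hull:
  assumes "E edge_of P" "S \<in> \<sigma> E"
  shows "cone_normal P (conic hull S) = inner_normal P E"
  using cone_edge_conic_hull subdivision_segment[OF assms] assms by (simp add: cone_normal_def)

lemma primitive_cone_normal:
  assumes "C \<in> primitive_T_cones P \<sigma>"
  shows "primitive (cone_normal P C)"
  using assms edge_facts(1) by (auto simp: primitive_T_cones_def cone_normal_conic_hull)

lemma finite_primitive_T_cones: "finite (primitive_T_cones P \<sigma>)"
proof -
  have "finite {E. E edge_of P}"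
    by (rule finite_subset[OF _ finite_polytope_faces[OF lattice_polytope_imp_polytope[OF lattice]]])
      (auto simp: edge_of_def)
  moreover have "finite (\<sigma> E)" if "E edge_of P" for E
    using that sub by (auto simp: polygon_subdivision_def edge_subdivision_def)
  ultimately have "finite (\<Union>E\<in>{E. E edge_of P}. (\<lambda>S. conic hull S) ` \<sigma> E)"
    by auto
  then show ?thesis
    by (rule finite_subset[rotated]) (auto simp: primitive_T_cones_def)
qed

text \<open>
  Whatever the subdivision, the number of T-cones over an edge is prescribed by its width and
  height.
\<close>

lemma card_T_cones_with_normal:
  assumes u: "primitive u"
  shows "card {C \<in> primitive_T_cones P \<sigma>. cone_normal P C = u} = T_number P u"
proof (cases "bottom_face (lattice_point u) P edge_of P")
  case True
  let ?E = "bottom_face (lattice_point u) P"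
  let ?S = "{S \<in> \<sigma> ?E. width S = edge_height P ?E}"
  have n: "inner_normal P ?E = u" by (rule inner_normal_bottom_face[OF u True])
  have "{C \<in> primitive_T_cones P \<sigma>. cone_normal P C = u} = (\<lambda>S. conic hull S) ` ?S"
  proof
    show "{C \<in> primitive_T_cones P \<sigma>. cone_normal P C = u} \<subseteq> (\<lambda>S. conic hull S) ` ?S"
    proof clarify
      fix C assume "C \<in> primitive_T_cones P \<sigma>" and u': "u = cone_normal P C"
      then obtain S E where S: "C = conic hull S" "E edge_of P" "S \<in> \<sigma> E" "width S = edge_height P E"
        by (auto simp: primitive_T_cones_def)
      then have "inner_normal P E = u"
        using cone_normal_conic_hull u' by simp
      then have "E = ?E" using edge_facts(2)[OF S(2)] by simp
      then show "C \<in> (\<lambda>S. conic hull S) ` {S \<in> \<sigma> (bottom_face (lattice_point (cone_normal P C)) P).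
          width S = edge_height P (bottom_face (lattice_point (cone_normal P C)) P)}"
        using S u' by auto
    qed
    show "(\<lambda>S. conic hull S) ` ?S \<subseteq> {C \<in> primitive_T_cones P \<sigma>. cone_normal P C = u}"
      using True cone_normal_conic_hull[OF True] n by (auto simp: primitive_T_cones_def)
  qed
  moreover have "inj_on (\<lambda>S. conic hull S) ?S"
  proof (rule inj_onI)
    fix S T assume "S \<in> ?S" "T \<in> ?S" and eq: "conic hull S = conic hull T"
    then have "S \<subseteq> ?E" "T \<subseteq> ?E" using subdivision_segment[OF True] by auto
    then show "S = T" using conic_hull_slice[OF True] eq by metis
  qed
  moreover have "card ?S = width ?E div edge_height P ?E"
    using sub True by (simp add: polygon_subdivision_def edge_subdivision_def Let_def)
  ultimately show ?thesis
    using edge_facts(3)[OF True] n by (simp add: card_image T_number_def)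
next
  case False
  then have "width (bottom_face (lattice_point u) P) = 0"
    using bottom_face_is_edge[OF u] by blast
  moreover have "{C \<in> primitive_T_cones P \<sigma>. cone_normal P C = u} = {}"
  proof -
    have "cone_normal P C \<noteq> u" if C: "C \<in> primitive_T_cones P \<sigma>" for C
    proof
      assume u': "cone_normal P C = u"
      obtain S E where S: "C = conic hull S" "E edge_of P" "S \<in> \<sigma> E"
        using C unfolding primitive_T_cones_def by blast
      then have "E = bottom_face (lattice_point u) P"
        using cone_normal_conic_hull u' edge_facts(2) by metis
      then show False using S False by simp
    qed
    then show ?thesis by blast
  qed
  ultimately show ?thesis unfolding T_number_def by (simp only: card.empty div_0)
qed

end

end

section \<open>Shears and lattice polytopes\<close>

definition shear :: "int \<times> int \<Rightarrow> int \<times> int \<Rightarrow> int \<Rightarrow> real \<times> real \<Rightarrow> real \<times> real" where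
  "shear w f c x = x - (real_of_int c * pairing w x) *\<^sub>R lattice_point f"

lemma linear_shear: "linear (shear w f c)"
  by (rule linearI) (auto simp: shear_def pairing_eq_inner algebra_simps inner_add_right)

lemma shear_uminus:
  assumes "pairing w (lattice_point f) = 0"
  shows "shear w f c (shear w f (- c) x) = x"
  using assms by (simp add: shear_def pairing_eq_inner algebra_simps inner_diff_right inner_add_right)

lemma shear_lattice_points:
  assumes "x \<in> lattice_points" shows "shear w f c x \<in> lattice_points"
proof -
  obtain u where u: "x = lattice_point u" using assms by (auto simp: lattice_points_def)
  have "shear w f c x = lattice_point u + real_of_int (- c * (fst w * fst u + snd w * snd u)) *\<^sub>R lattice_point f"
    by (simp add: shear_def u pairing_lattice_point)
  then show ?thesis unfolding lattice_point_combination by simp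
qed

lemma width_shear:
  assumes "pairing w (lattice_point f) = 0"
  shows "width (shear w f c ` S) = width S"
proof -
  have inj: "inj (shear w f c)"
    using shear_uminus[OF assms, of "- c"] by (metis injI minus_minus)
  have "shear w f c ` S \<inter> lattice_points = shear w f c ` (S \<inter> lattice_points)"
  proof
    show "shear w f c ` S \<inter> lattice_points \<subseteq> shear w f c ` (S \<inter> lattice_points)"
    proof
      fix y assume "y \<in> shear w f c ` S \<inter> lattice_points"
      then obtain x where x: "x \<in> S" "y = shear w f c x" "y \<in> lattice_points" by blast
      then have "x = shear w f (- c) y"
        using shear_uminus[OF assms, of "- c" x] by simp
      then have "x \<in> lattice_points" using shear_lattice_points[OF x(3), of w f "- c"] by simp
      then show "y \<in> shear w f c ` (S \<inter> lattice_points)" using x by blast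
    qed
  qed (auto intro: shear_lattice_points)
  then show ?thesis
    using inj by (simp add: width_def card_image inj_on_subset)
qed

text \<open>
  The transpose of the shear, acting on functionals.
\<close>

lemma inner_shear:
  "a \<bullet> shear w f c x = (a - (real_of_int c * (a \<bullet> lattice_point f)) *\<^sub>R lattice_point w) \<bullet> x"
  by (simp add: shear_def pairing_eq_inner algebra_simps inner_diff_left inner_diff_right)

lemma lattice_polytope_hull:
  "finite V \<Longrightarrow> V \<subseteq> lattice_points \<Longrightarrow> lattice_polytope (convex hull V)"
  by (auto simp: lattice_polytope_def)

lemma lattice_polytope_plus:
  assumes "lattice_polytope A" "lattice_polytope B"
  shows "lattice_polytope (A + B)"
proof -
  obtain V W where V: "finite V" "V \<subseteq> lattice_points" "A = convex hull V"
    and W: "finite W" "W \<subseteq> lattice_points" "B = convex hull W"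
    using assms by (auto simp: lattice_polytope_def)
  have closed: "x + y \<in> lattice_points" if "x \<in> lattice_points" "y \<in> lattice_points" for x y
  proof -
    from that obtain u v where uv: "x = lattice_point u" "y = lattice_point v"
      unfolding lattice_points_def by blast
    then have "x + y = lattice_point (fst u + fst v, snd u + snd v)"
      by (simp add: lattice_point_def)
    then show ?thesis by simp
  qed
  have "V + W \<subseteq> lattice_points"
  proof
    fix z assume "z \<in> V + W"
    then show "z \<in> lattice_points"
      by (rule set_plus_elim) (use closed V(2) W(2) in blast)
  qed
  moreover have "finite (V + W)" using V(1) W(1) by (rule finite_set_plus)
  ultimately show ?thesis
    unfolding lattice_polytope_def V(3) W(3) by (metis convex_hull_set_plus)
qed

lemma lattice_polytope_hull_Union:
  assumes "finite I" "\<And>i. i \<in> I \<Longrightarrow> lattice_polytope (A i)"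
  shows "lattice_polytope (convex hull (\<Union>i\<in>I. A i))"
proof -
  obtain V where V: "\<And>i. i \<in> I \<Longrightarrow> finite (V i) \<and> V i \<subseteq> lattice_points \<and> A i = convex hull (V i)"
    using assms(2) unfolding lattice_polytope_def by metis
  have "convex hull (\<Union>i\<in>I. A i) = convex hull (\<Union>i\<in>I. V i)"
  proof
    have "A i \<subseteq> convex hull (\<Union>i\<in>I. V i)" if "i \<in> I" for i
      using V[OF that] hull_mono[of "V i" "\<Union>i\<in>I. V i" convex] that by auto
    then show "convex hull (\<Union>i\<in>I. A i) \<subseteq> convex hull (\<Union>i\<in>I. V i)"
      by (intro hull_minimal) auto
    show "convex hull (\<Union>i\<in>I. V i) \<subseteq> convex hull (\<Union>i\<in>I. A i)"
      using V by (intro hull_mono UN_mono) (auto intro: hull_inc)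
  qed
  moreover have "finite (\<Union>i\<in>I. V i)" "(\<Union>i\<in>I. V i) \<subseteq> lattice_points"
    using V assms(1) by auto
  ultimately show ?thesis by (simp add: lattice_polytope_hull)
qed

lemma lattice_polytope_primitive_segment: "lattice_polytope (dilate r (convex hull {0, lattice_point f}))"
proof -
  have "linear (\<lambda>x::real \<times> real. real_of_int r *\<^sub>R x)" by (simp add: linear_iff algebra_simps)
  then have eq: "dilate r (convex hull {0, lattice_point f}) = convex hull {0, real_of_int r *\<^sub>R lattice_point f}"
    unfolding dilate_def by (simp add: convex_hull_linear_image)
  have "{0, real_of_int r *\<^sub>R lattice_point f} \<subseteq> lattice_points"
    using lattice_point_combination[of "(0,0)" r f] lattice_point_in_lattice_points[of "(0,0)"]
      lattice_point_in_lattice_points[of "(r * fst f, r * snd f)"]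
    by (auto simp: lattice_point_def zero_prod_def)
  then show ?thesis
    unfolding eq by (intro lattice_polytope_hull) auto
qed

lemma finite_bounded_lattice_points:
  assumes "bounded S" shows "finite (S \<inter> lattice_points)"
proof -
  obtain B where B: "\<And>x. x \<in> S \<Longrightarrow> norm x \<le> B"
    using assms by (auto simp: bounded_iff)
  have "S \<inter> lattice_points \<subseteq> lattice_point ` ({- \<lceil>B\<rceil>..\<lceil>B\<rceil>} \<times> {- \<lceil>B\<rceil>..\<lceil>B\<rceil>})"
  proof
    fix x assume "x \<in> S \<inter> lattice_points"
    then obtain u where u: "x = lattice_point u" "x \<in> S" by (auto simp: lattice_points_def)
    have "norm (fst x) \<le> B" "norm (snd x) \<le> B"
      using B[OF u(2)] norm_fst_le[of "fst x" "snd x"] norm_snd_le[of "snd x" "fst x"] by auto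
    then have "\<bar>real_of_int (fst u)\<bar> \<le> B" "\<bar>real_of_int (snd u)\<bar> \<le> B"
      by (simp_all add: u(1) lattice_point_def)
    then have "fst u \<in> {- \<lceil>B\<rceil>..\<lceil>B\<rceil>}" "snd u \<in> {- \<lceil>B\<rceil>..\<lceil>B\<rceil>}"
      by (auto simp: abs_le_iff) linarith+
    then show "x \<in> lattice_point ` ({- \<lceil>B\<rceil>..\<lceil>B\<rceil>} \<times> {- \<lceil>B\<rceil>..\<lceil>B\<rceil>})"
      using u(1) by (metis imageI mem_Times_iff)
  qed
  then show ?thesis by (rule finite_subset) simp
qed

section \<open>Faces of the mutated polygon\<close>

text \<open>
  This is the map \<open>\<phi>\<close> on functionals. It is defined on real ones, since the proof that the
  origin is interior to the mutated polygon tests against all directions.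
\<close>

definition dual_mutation :: "int \<times> int \<Rightarrow> int \<times> int \<Rightarrow> real \<times> real \<Rightarrow> real \<times> real" where
  "dual_mutation w f a = a - min 0 (a \<bullet> lattice_point f) *\<^sub>R lattice_point w"

locale mutation_setting = lattice_polygon +
  fixes w f :: "int \<times> int" and G :: "int \<Rightarrow> (real \<times> real) set"
  assumes w: "primitive w" and f: "primitive f"
    and wf: "pairing w (lattice_point f) = 0"
    and data: "mutation_data P w (convex hull {0, lattice_point f}) G"
begin

abbreviation "F \<equiv> convex hull {0, lattice_point f}"

abbreviation "P' \<equiv> mutated_polygon P w F G"

definition lower_levels :: "int set" where
  "lower_levels = {h. min_level w P \<le> real_of_int h \<and> h < 0}"

definition upper_levels :: "int set" where
  "upper_levels = {h. 0 \<le> h \<and> real_of_int h \<le> max_level w P}"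

definition pieces :: "(real \<times> real) set" where
  "pieces = (\<Union>h\<in>lower_levels. G h) \<union> (\<Union>h\<in>upper_levels. level_hull w h P + dilate h F)"

lemma mutated_polygon_eq: "P' = convex hull pieces"
  by (simp add: mutated_polygon_def pieces_def lower_levels_def upper_levels_def)

lemma w': "primitive (- fst w, - snd w)" by (rule primitive_uminus[OF w])

lemma pairing_uminus: "pairing (- fst w, - snd w) x = - pairing w x"
  by (simp add: pairing_def)

lemma max_level_eq: "max_level w P = real (height (- fst w, - snd w) P)"
proof -
  let ?w = "(- fst w, - snd w)"
  obtain x where x: "x \<in> P" "pairing ?w x = - real (height ?w P)"
    using height_props(3,4)[OF w'] by blast
  have "pairing w y \<le> real (height ?w P)" if "y \<in> P" for y
    using height_props(5)[OF w' that] by (simp add: pairing_uminus)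
  then show ?thesis
    unfolding max_level_def using x
    by (intro cSup_eq_maximum image_eqI[of _ _ x]) (auto simp: pairing_uminus)
qed

lemma lower_levels_eq: "lower_levels = {- int (height w P)..<0}"
  unfolding lower_levels_def height_props(1)[OF w] by auto

lemma upper_levels_eq: "upper_levels = {0..int (height (- fst w, - snd w) P)}"
  unfolding upper_levels_def max_level_eq by auto

lemma G_data:
  assumes "h \<in> lower_levels"
  shows "lattice_polytope (G h)"
    and "{x. x extreme_point_of P \<and> pairing w x = real_of_int h} \<subseteq> G h + dilate \<bar>h\<bar> F"
    and "G h + dilate \<bar>h\<bar> F \<subseteq> level_hull w h P"
  using data assms by (auto simp: mutation_data_def lower_levels_def)

lemma lattice_polytope_level_hull: "lattice_polytope (level_hull w h P)"
proof -
  have "finite (P \<inter> lattice_points)"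
    using lattice by (intro finite_bounded_lattice_points polytope_imp_bounded lattice_polytope_imp_polytope)
  then have "finite {x \<in> P \<inter> lattice_points. pairing w x = real_of_int h}"
    by (rule finite_subset[rotated]) auto
  then show ?thesis unfolding level_hull_def by (rule lattice_polytope_hull) auto
qed

lemma level_hull_subset:
  assumes "x \<in> level_hull w h P" shows "x \<in> P" "pairing w x = real_of_int h"
proof -
  have "level_hull w h P \<subseteq> P \<inter> {x. lattice_point w \<bullet> x = real_of_int h}"
    unfolding level_hull_def
    by (intro hull_minimal convex_Int convex_P convex_hyperplane) (auto simp: pairing_eq_inner)
  then show "x \<in> P" "pairing w x = real_of_int h" using assms by (auto simp: pairing_eq_inner)
qed

lemma lattice_polytope_mutated: "lattice_polytope P'"
proof -
  let ?A = "case_sum G (\<lambda>h. level_hull w h P + dilate h F)"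
  have "pieces = (\<Union>i \<in> Inl ` lower_levels \<union> Inr ` upper_levels. ?A i)"
    by (simp add: pieces_def UN_Un)
  moreover have "lattice_polytope (convex hull (\<Union>i \<in> Inl ` lower_levels \<union> Inr ` upper_levels. ?A i))"
  proof (rule lattice_polytope_hull_Union)
    show "finite (Inl ` lower_levels \<union> Inr ` upper_levels :: (int + int) set)"
      by (simp add: lower_levels_eq upper_levels_eq)
  next
    fix i :: "int + int" assume "i \<in> Inl ` lower_levels \<union> Inr ` upper_levels"
    then show "lattice_polytope (?A i)"
      using G_data(1) lattice_polytope_plus[OF lattice_polytope_level_hull lattice_polytope_primitive_segment]
      by (elim UnE imageE) simp_all
  qed
  ultimately show ?thesis by (simp add: mutated_polygon_eq)
qed

lemma lower_piece:
  assumes "h \<in> lower_levels" "g \<in> G h" "0 \<le> t" "t \<le> 1"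
  shows "g + (real_of_int \<bar>h\<bar> * t) *\<^sub>R lattice_point f \<in> P"
    and "pairing w (g + (real_of_int \<bar>h\<bar> * t) *\<^sub>R lattice_point f) = real_of_int h"
proof -
  have "(real_of_int \<bar>h\<bar> * t) *\<^sub>R lattice_point f \<in> dilate \<bar>h\<bar> F"
    unfolding dilate_primitive_segment[OF abs_ge_zero]
    using assms(3,4) by (intro imageI) (auto simp: mult_left_le)
  then have "g + (real_of_int \<bar>h\<bar> * t) *\<^sub>R lattice_point f \<in> level_hull w h P"
    using set_plus_intro[OF assms(2)] G_data(3)[OF assms(1)] by blast
  then show "g + (real_of_int \<bar>h\<bar> * t) *\<^sub>R lattice_point f \<in> P"
    "pairing w (g + (real_of_int \<bar>h\<bar> * t) *\<^sub>R lattice_point f) = real_of_int h"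
    by (rule level_hull_subset)+
qed

lemma pairing_G:
  assumes "h \<in> lower_levels" "g \<in> G h" shows "pairing w g = real_of_int h"
  using lower_piece(2)[OF assms, of 0] by simp

lemma upper_piece:
  assumes "h \<in> upper_levels" "x \<in> level_hull w h P + dilate h F"
  obtains y t where "y \<in> P" "pairing w y = real_of_int h" "0 \<le> t" "t \<le> 1"
    "x = y + (real_of_int h * t) *\<^sub>R lattice_point f"
proof -
  have h: "0 \<le> h" using assms(1) by (simp add: upper_levels_def)
  obtain y s where y: "y \<in> level_hull w h P" and s: "0 \<le> s" "s \<le> real_of_int h"
    and x: "x = y + s *\<^sub>R lattice_point f"
    using assms(2) unfolding dilate_primitive_segment[OF h] by (auto simp: set_plus_def)
  have "s = real_of_int h * (if h = 0 then 0 else s / real_of_int h)" using s by auto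
  moreover have "0 \<le> (if h = 0 then 0 else s / real_of_int h)" "(if h = 0 then 0 else s / real_of_int h) \<le> 1"
    using s h by auto
  ultimately show ?thesis using that level_hull_subset[OF y] x by metis
qed

lemma pairing_shift: "pairing w (x + s *\<^sub>R lattice_point f) = pairing w x"
  using wf by (simp add: pairing_eq_inner inner_add_right)

text \<open>
  Where \<open>\<phi>\<close> is linear it is the transpose of a shear; this is the exponent of that shear on the
  half-plane containing \<open>a\<close>.
\<close>

definition correction :: "real \<times> real \<Rightarrow> int" where
  "correction a = (if a \<bullet> lattice_point f < 0 then 1 else 0)"

lemma inner_shear_correction: "a \<bullet> shear w f (correction a) x = dual_mutation w f a \<bullet> x"
  unfolding inner_shear by (simp add: correction_def dual_mutation_def)

text \<open>
  The shear moves a point of \<open>G h\<close> to an end of a translate of the segment \<open>\<bar>h\<bar> F\<close> that lies in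
  \<open>P\<close>. A point of an expanded level \<open>y + h t f\<close> is moved to \<open>y + h (t - c) f\<close> with \<open>c\<close> the
  exponent, and \<open>c\<close> is chosen so that \<open>a\<close> takes its minimum over \<open>t \<in> [0, 1]\<close> at \<open>t = c\<close>.
\<close>

lemma pieces_above:
  assumes "x \<in> pieces"
  obtains z where "z \<in> P" "a \<bullet> z \<le> a \<bullet> shear w f (correction a) x"
    and "a \<bullet> lattice_point f \<noteq> 0 \<Longrightarrow> a \<bullet> z = a \<bullet> shear w f (correction a) x \<Longrightarrow> shear w f (correction a) x = z"
proof -
  let ?c = "correction a"
  have "(\<exists>h\<in>lower_levels. x \<in> G h) \<or> (\<exists>h\<in>upper_levels. x \<in> level_hull w h P + dilate h F)"
    using assms by (auto simp: pieces_def)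
  then show ?thesis
  proof (elim disjE bexE)
    fix h assume h: "h \<in> lower_levels" "x \<in> G h"
    then have "shear w f ?c x = x + (real_of_int \<bar>h\<bar> * real_of_int ?c) *\<^sub>R lattice_point f"
      using pairing_G[OF h] by (simp add: shear_def lower_levels_def algebra_simps)
    moreover have "x + (real_of_int \<bar>h\<bar> * real_of_int ?c) *\<^sub>R lattice_point f \<in> P"
      by (rule lower_piece(1)[OF h]) (auto simp: correction_def)
    ultimately show ?thesis using that by (metis order_refl)
  next
    fix h assume h: "h \<in> upper_levels" "x \<in> level_hull w h P + dilate h F"
    obtain y t where y: "y \<in> P" "pairing w y = real_of_int h" and t: "0 \<le> t" "t \<le> 1"
      and x: "x = y + (real_of_int h * t) *\<^sub>R lattice_point f"
      by (rule upper_piece[OF h])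
    have shear: "shear w f ?c x = y + (real_of_int h * (t - ?c)) *\<^sub>R lattice_point f"
      using y(2) by (simp add: shear_def x pairing_shift algebra_simps)
    then have val: "a \<bullet> shear w f ?c x = a \<bullet> y + real_of_int h * ((t - ?c) * (a \<bullet> lattice_point f))"
      by (simp add: inner_add_right)
    have nonneg: "(t - ?c) * (a \<bullet> lattice_point f) \<ge> 0"
      using t by (auto simp: correction_def mult_nonpos_nonpos)
    have "0 \<le> real_of_int h" using h(1) by (simp add: upper_levels_def)
    then have "a \<bullet> y \<le> a \<bullet> shear w f ?c x"
      unfolding val using nonneg by simp
    moreover have "shear w f ?c x = y" if "a \<bullet> lattice_point f \<noteq> 0" "a \<bullet> y = a \<bullet> shear w f ?c x"
      using that unfolding val unfolding shear by auto
    ultimately show ?thesis using that y(1) by blast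
  qed
qed

text \<open>
  At a negative level, \<open>x\<close> lies on a segment \<open>g + \<bar>h\<bar> F\<close> inside \<open>P\<close> with \<open>g \<in> G h\<close>. Since \<open>a\<close> is
  minimal at \<open>x\<close>, it must be constant on the segment or \<open>x\<close> must be the end to which the shear
  moves \<open>g\<close>. At a nonnegative level, shearing back \<open>x\<close> stays within the expanded level.
\<close>

lemma vertex_lift:
  assumes x: "x extreme_point_of P" "x \<in> bottom_face a P"
  obtains x' where "x' \<in> pieces" "a \<bullet> shear w f (correction a) x' = a \<bullet> x"
    and "a \<bullet> lattice_point f \<noteq> 0 \<Longrightarrow> shear w f (correction a) x' = x"
proof -
  let ?c = "correction a"
  obtain v where v: "x = lattice_point v" by (rule lattice_polytope_vertex[OF lattice x(1)])
  define h where "h = fst w * fst v + snd w * snd v"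
  have wx: "pairing w x = real_of_int h" by (simp add: v h_def pairing_lattice_point)
  have xP: "x \<in> P" using x(2) by (simp add: bottom_face_def)
  have hmin: "- int (height w P) \<le> h"
    using height_props(5)[OF w xP] wx by simp
  have hmax: "h \<le> int (height (- fst w, - snd w) P)"
    using height_props(5)[OF w' xP] wx by (simp add: pairing_uminus)
  show ?thesis
  proof (cases "h < 0")
    case True
    then have h: "h \<in> lower_levels" using hmin by (simp add: lower_levels_eq)
    then have "x \<in> G h + dilate \<bar>h\<bar> F" using G_data(2) x(1) wx by blast
    then obtain g s where g: "g \<in> G h" and s: "0 \<le> s" "s \<le> real_of_int \<bar>h\<bar>"
      and x_eq: "x = g + s *\<^sub>R lattice_point f"
      unfolding dilate_primitive_segment[OF abs_ge_zero] by (auto simp: set_plus_def)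
    have shear: "shear w f ?c g = g + (real_of_int \<bar>h\<bar> * real_of_int ?c) *\<^sub>R lattice_point f"
      using pairing_G[OF h g] True by (simp add: shear_def algebra_simps)
    have "shear w f ?c g \<in> P"
      unfolding shear by (rule lower_piece(1)[OF h g]) (auto simp: correction_def)
    then have "a \<bullet> x \<le> a \<bullet> shear w f ?c g" using x(2) by (simp add: bottom_face_def)
    moreover have "a \<bullet> shear w f ?c g = a \<bullet> x + (real_of_int \<bar>h\<bar> * ?c - s) * (a \<bullet> lattice_point f)"
      unfolding shear x_eq by (simp add: inner_add_right algebra_simps)
    moreover have "(real_of_int \<bar>h\<bar> * ?c - s) * (a \<bullet> lattice_point f) \<le> 0"
      using s by (auto simp: correction_def mult_nonneg_nonpos)
    ultimately have eq: "(real_of_int \<bar>h\<bar> * ?c - s) * (a \<bullet> lattice_point f) = 0"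
      and val: "a \<bullet> shear w f ?c g = a \<bullet> x" by linarith+
    have "shear w f ?c g = x" if "a \<bullet> lattice_point f \<noteq> 0"
      using eq that unfolding shear x_eq by simp
    moreover have "g \<in> pieces" using g h by (auto simp: pieces_def)
    ultimately show ?thesis using that val by blast
  next
    case False
    then have h: "h \<in> upper_levels" using hmax by (simp add: upper_levels_eq)
    define x' where "x' = x + (real_of_int h * ?c) *\<^sub>R lattice_point f"
    have "x \<in> level_hull w h P"
      unfolding level_hull_def using xP wx v by (intro hull_inc) auto
    moreover have "(real_of_int h * ?c) *\<^sub>R lattice_point f \<in> dilate h F"
      using False unfolding dilate_primitive_segment[OF leI[OF False]]
      by (intro imageI) (auto simp: correction_def)
    ultimately have "x' \<in> level_hull w h P + dilate h F"
      unfolding x'_def by (rule set_plus_intro)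
    then have "x' \<in> pieces" using h by (auto simp: pieces_def)
    moreover have "shear w f ?c x' = x"
      by (simp add: shear_def x'_def pairing_shift wx algebra_simps)
    ultimately show ?thesis using that by simp
  qed
qed

lemma bottom_value_mutated:
  assumes x: "x \<in> bottom_face a P" and y: "y \<in> P'"
  shows "a \<bullet> x \<le> dual_mutation w f a \<bullet> y"
proof (rule convex_hull_lower_bound)
  show "y \<in> convex hull pieces" using y by (simp add: mutated_polygon_eq)
next
  fix z assume "z \<in> pieces"
  then obtain z' where "z' \<in> P" "a \<bullet> z' \<le> a \<bullet> shear w f (correction a) z"
    by (rule pieces_above)
  then show "a \<bullet> x \<le> dual_mutation w f a \<bullet> z"
    using x unfolding inner_shear_correction bottom_face_def by fastforce
qed

lemma bottom_value_attained:
  obtains x y where "x \<in> bottom_face a P" "y \<in> bottom_face (dual_mutation w f a) P'"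
    "dual_mutation w f a \<bullet> y = a \<bullet> x"
proof -
  have "P \<noteq> {}" using origin interior_subset by blast
  then obtain x where x: "x extreme_point_of P" "x \<in> bottom_face a P"
    using minimizing_vertex lattice_polytope_imp_polytope[OF lattice] by metis
  then obtain y where y: "y \<in> pieces" "dual_mutation w f a \<bullet> y = a \<bullet> x"
    using vertex_lift unfolding inner_shear_correction by metis
  then have "y \<in> P'" by (simp add: mutated_polygon_eq hull_inc)
  then have "y \<in> bottom_face (dual_mutation w f a) P'"
    using bottom_value_mutated[OF x(2)] y(2) by (simp add: bottom_face_def)
  then show ?thesis using that x(2) y(2) by blast
qed

text \<open>
  Otherwise some functional \<open>a \<noteq> 0\<close> is nonnegative on the mutated polygon. But \<open>a = \<phi>(b)\<close> for some
  \<open>b \<noteq> 0\<close>, whose minimum on \<open>P\<close> is negative and is attained by \<open>a\<close> on the mutated polygon.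
\<close>

lemma origin_interior_mutated: "0 \<in> interior P'"
proof (rule ccontr)
  assume "0 \<notin> interior P'"
  have conv: "convex P'" by (simp add: mutated_polygon_eq)
  have "\<exists>a. a \<noteq> 0 \<and> (\<forall>x\<in>P'. 0 \<le> a \<bullet> x)"
  proof (cases "interior P' = {}")
    case True
    then obtain a b where a: "a \<noteq> 0" "P' \<subseteq> {x. a \<bullet> x = b}"
      using empty_interior_subset_hyperplane[OF conv] by blast
    show ?thesis
    proof (cases "0 \<le> b")
      case True
      then show ?thesis using a by (intro exI[of _ a]) auto
    next
      case False
      then show ?thesis using a by (intro exI[of _ "- a"]) auto
    qed
  next
    case False
    obtain a where a: "a \<noteq> 0" "\<forall>x\<in>interior P'. 0 \<le> a \<bullet> x"
      using separating_hyperplane_set_0[OF convex_interior[OF conv] \<open>0 \<notin> interior P'\<close>] by blast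
    have "closure (interior P') \<subseteq> {x. 0 \<le> a \<bullet> x}"
      using a(2) by (intro closure_minimal) (auto simp: closed_halfspace_ge)
    then have "P' \<subseteq> {x. 0 \<le> a \<bullet> x}"
      using convex_closure_interior[OF conv False] closure_subset by blast
    then show ?thesis using a(1) by (intro exI[of _ a]) auto
  qed
  then obtain a where a: "a \<noteq> 0" "\<And>x. x \<in> P' \<Longrightarrow> 0 \<le> a \<bullet> x" by blast
  \<comment> \<open>the preimage of \<open>a\<close>: adding multiples of \<open>w\<close> does not change the value at \<open>f\<close>\<close>
  define b where "b = a + min 0 (a \<bullet> lattice_point f) *\<^sub>R lattice_point w"
  have bf: "b \<bullet> lattice_point f = a \<bullet> lattice_point f"
    using wf by (simp add: b_def inner_add_left pairing_eq_inner)
  then have mut: "dual_mutation w f b = a"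
    unfolding dual_mutation_def by (simp add: b_def)
  have "b \<noteq> 0"
    using mut a(1) by (auto simp: dual_mutation_def)
  then obtain y where y: "y \<in> P" "b \<bullet> y < 0"
    using negative_direction[OF origin] by blast
  obtain x x' where "x \<in> bottom_face b P" "x' \<in> bottom_face a P'" "a \<bullet> x' = b \<bullet> x"
    using bottom_value_attained[of b] unfolding mut by blast
  then show False
    using a(2)[of x'] y by (fastforce simp: bottom_face_def)
qed

sublocale mutated: lattice_polygon P'
  by unfold_locales (rule lattice_polytope_mutated origin_interior_mutated)+

text \<open>
  Both faces are hulls of the generators on which the functional is minimal. These generators
  correspond by \<open>pieces_above\<close> in one direction and \<open>vertex_lift\<close> in the other.
\<close>

lemma shear_bottom_face:
  assumes "a \<bullet> lattice_point f \<noteq> 0"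
  shows "shear w f (correction a) ` bottom_face (dual_mutation w f a) P' = bottom_face a P"
proof -
  let ?A = "shear w f (correction a)" and ?a = "dual_mutation w f a"
  obtain x y where x: "x \<in> bottom_face a P" and y: "y \<in> bottom_face ?a P'" and xy: "?a \<bullet> y = a \<bullet> x"
    by (rule bottom_value_attained)
  have "bottom_face ?a P' = {z \<in> convex hull pieces. ?a \<bullet> z = a \<bullet> x}"
    using bottom_face_level[OF y] xy by (simp add: mutated_polygon_eq)
  also have "\<dots> = convex hull {z \<in> pieces. ?a \<bullet> z = a \<bullet> x}"
    using bottom_value_mutated[OF x] by (intro convex_hull_minimal_level) (simp add: mutated_polygon_eq hull_inc)
  finally have face: "?A ` bottom_face ?a P' = convex hull (?A ` {z \<in> pieces. ?a \<bullet> z = a \<bullet> x})"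
    by (simp add: convex_hull_linear_image linear_shear)
  have in_face: "?A z \<in> bottom_face a P" if z: "z \<in> pieces" "?a \<bullet> z = a \<bullet> x" for z
  proof -
    obtain z' where z': "z' \<in> P" "a \<bullet> z' \<le> a \<bullet> ?A z" "a \<bullet> z' = a \<bullet> ?A z \<Longrightarrow> ?A z = z'"
      using pieces_above[OF z(1)] assms by metis
    moreover have "a \<bullet> ?A z = a \<bullet> x" using z(2) by (simp add: inner_shear_correction)
    ultimately have "?A z = z'" "a \<bullet> z' = a \<bullet> x"
      using x by (auto simp: bottom_face_def intro!: antisym)
    then show ?thesis using z'(1) bottom_face_level[OF x] by simp
  qed
  have "convex (bottom_face a P)"
    using lattice_polytope_bottom_face[OF lattice] by (simp add: lattice_polytope_imp_polytope polytope_imp_convex)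
  then have "convex hull (?A ` {z \<in> pieces. ?a \<bullet> z = a \<bullet> x}) \<subseteq> bottom_face a P"
    using in_face by (intro hull_minimal) auto
  moreover have "bottom_face a P \<subseteq> convex hull (?A ` {z \<in> pieces. ?a \<bullet> z = a \<bullet> x})"
  proof -
    have "v \<in> ?A ` {z \<in> pieces. ?a \<bullet> z = a \<bullet> x}" if v: "v extreme_point_of P" "v \<in> bottom_face a P" for v
    proof -
      obtain v' where "v' \<in> pieces" "a \<bullet> ?A v' = a \<bullet> v" "?A v' = v"
        using vertex_lift[OF v] assms by metis
      moreover have "a \<bullet> v = a \<bullet> x" using v(2) bottom_face_level[OF x] by blast
      ultimately show ?thesis by (auto simp: inner_shear_correction)
    qed
    then have "convex hull {v. v extreme_point_of P \<and> v \<in> bottom_face a P} \<subseteq>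
        convex hull (?A ` {z \<in> pieces. ?a \<bullet> z = a \<bullet> x})"
      by (intro hull_mono) auto
    then show ?thesis
      using bottom_face_eq_hull_vertices[OF lattice_polytope_imp_polytope[OF lattice], of a] by simp
  qed
  ultimately show ?thesis using face by simp
qed


end

section \<open>Counting T-cones of the mutated polygon\<close>

text \<open>
  The restriction of \<open>\<phi>\<close> to integral covectors.
\<close>

definition mutated_normal :: "int \<times> int \<Rightarrow> int \<times> int \<Rightarrow> int \<times> int \<Rightarrow> int \<times> int" where
  "mutated_normal w f u =
     (let m = min 0 (fst u * fst f + snd u * snd f) in (fst u - m * fst w, snd u - m * snd w))"

lemma lattice_point_mutated_normal:
  "lattice_point (mutated_normal w f u) = dual_mutation w f (lattice_point u)"
proof -
  have "lattice_point u \<bullet> lattice_point f = real_of_int (fst u * fst f + snd u * snd f)"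
    using pairing_lattice_point unfolding pairing_eq_inner .
  then have "min 0 (lattice_point u \<bullet> lattice_point f) = real_of_int (min 0 (fst u * fst f + snd u * snd f))"
    by (simp add: of_int_min)
  then show ?thesis
    unfolding dual_mutation_def mutated_normal_def Let_def by (simp add: lattice_point_def)
qed

context mutation_setting
begin

lemma wf_int: "fst w * fst f + snd w * snd f = 0"
  using wf unfolding pairing_lattice_point of_int_eq_0_iff .

lemma mutated_normal_value:
  "fst (mutated_normal w f u) * fst f + snd (mutated_normal w f u) * snd f = fst u * fst f + snd u * snd f"
proof -
  obtain m where "mutated_normal w f u = (fst u - m * fst w, snd u - m * snd w)"
    unfolding mutated_normal_def Let_def by blast
  moreover have "(fst u - m * fst w) * fst f + (snd u - m * snd w) * snd f =
      fst u * fst f + snd u * snd f - m * (fst w * fst f + snd w * snd f)"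
    by (simp add: algebra_simps)
  ultimately show ?thesis using wf_int by simp
qed

lemma primitive_mutated_normal:
  assumes "primitive u" shows "primitive (mutated_normal w f u)"
  unfolding primitive_def
proof (rule coprimeI)
  define m where "m = min 0 (fst u * fst f + snd u * snd f)"
  have eq: "mutated_normal w f u = (fst u - m * fst w, snd u - m * snd w)"
    by (simp add: mutated_normal_def Let_def m_def)
  fix d assume d: "d dvd fst (mutated_normal w f u)" "d dvd snd (mutated_normal w f u)"
  then have "d dvd fst (mutated_normal w f u) * fst f + snd (mutated_normal w f u) * snd f"
    by (simp add: dvd_add)
  then have "d dvd fst u * fst f + snd u * snd f"
    by (simp only: mutated_normal_value)
  then have m: "d dvd m" by (simp add: m_def min_def)
  have "d dvd fst u" "d dvd snd u"
    using dvd_add[OF d(1) dvd_mult2[OF m, of "fst w"]] dvd_add[OF d(2) dvd_mult2[OF m, of "snd w"]]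
    by (simp_all only: eq fst_conv snd_conv diff_add_cancel)
  then show "is_unit d" using assms by (simp add: primitive_def coprime_def)
qed

lemma mutated_normal_inj: "mutated_normal w f u = mutated_normal w f v \<Longrightarrow> u = v"
proof -
  assume eq: "mutated_normal w f u = mutated_normal w f v"
  then have "fst u * fst f + snd u * snd f = fst v * fst f + snd v * snd f"
    using mutated_normal_value by metis
  then show "u = v"
    using eq by (simp add: mutated_normal_def Let_def prod_eq_iff)
qed

lemma mutated_normal_surj:
  assumes "primitive u" obtains v where "primitive v" "mutated_normal w f v = u"
proof -
  define m where "m = min 0 (fst u * fst f + snd u * snd f)"
  define v where "v = (fst u + m * fst w, snd u + m * snd w)"
  have "fst v * fst f + snd v * snd f =
      fst u * fst f + snd u * snd f + m * (fst w * fst f + snd w * snd f)"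
    by (simp add: v_def algebra_simps)
  then have val: "fst v * fst f + snd v * snd f = fst u * fst f + snd u * snd f"
    using wf_int by simp
  have eq: "mutated_normal w f v = u"
    unfolding mutated_normal_def Let_def val m_def[symmetric] by (simp add: v_def)
  have "primitive v"
    unfolding primitive_def
  proof (rule coprimeI)
    fix d assume d: "d dvd fst v" "d dvd snd v"
    then have "d dvd fst v * fst f + snd v * snd f"
      by (simp add: dvd_add)
    then have m: "d dvd m"
      unfolding m_def val by (simp add: min_def)
    have "d dvd fst u" "d dvd snd u"
      using dvd_diff[OF d(1) dvd_mult2[OF m, of "fst w"]] dvd_diff[OF d(2) dvd_mult2[OF m, of "snd w"]]
      by (simp_all only: v_def fst_conv snd_conv add_diff_cancel_right')
    then show "is_unit d" using assms by (simp add: primitive_def coprime_def)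
  qed
  then show ?thesis using that eq by blast
qed

lemma mutated_normal_w:
  "mutated_normal w f w = w" "mutated_normal w f (- fst w, - snd w) = (- fst w, - snd w)"
  using wf_int by (auto simp: mutated_normal_def)

lemma height_mutated: "height (mutated_normal w f u) P' = height u P"
proof -
  obtain x y where "x \<in> bottom_face (lattice_point u) P"
      "y \<in> bottom_face (lattice_point (mutated_normal w f u)) P'"
      "lattice_point (mutated_normal w f u) \<bullet> y = lattice_point u \<bullet> x"
    using bottom_value_attained[of "lattice_point u"] unfolding lattice_point_mutated_normal by blast
  then have "min_level (mutated_normal w f u) P' = min_level u P"
    using min_level_eq by (simp add: pairing_eq_inner)
  then show ?thesis by (simp add: height_def)
qed

lemma T_number_generic:
  assumes "fst u * fst f + snd u * snd f \<noteq> 0"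
  shows "T_number P' (mutated_normal w f u) = T_number P u"
proof -
  have "lattice_point u \<bullet> lattice_point f \<noteq> 0"
    using assms pairing_lattice_point[of u f] unfolding pairing_eq_inner by (metis of_int_eq_0_iff)
  then have "width (bottom_face (lattice_point (mutated_normal w f u)) P') = width (bottom_face (lattice_point u) P)"
    using shear_bottom_face width_shear[OF wf] unfolding lattice_point_mutated_normal by metis
  then show ?thesis by (simp add: T_number_def height_mutated)
qed

lemma kernel_normals:
  assumes u: "primitive u" and uf: "fst u * fst f + snd u * snd f = 0"
  shows "u = w \<or> u = (- fst w, - snd w)"
proof -
  have "fst f * fst u + snd f * snd u = 0" "fst f * fst w + snd f * snd w = 0"
    using uf wf_int by (simp_all add: algebra_simps)
  then obtain j where j: "fst u = j * fst w" "snd u = j * snd w"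
    using integer_kernel[OF f w, of "fst u" "snd u"] by metis
  then have "is_unit j"
    using u unfolding primitive_def coprime_def by (metis dvd_triv_left)
  then have "j = 1 \<or> j = - 1" by auto
  then show ?thesis using j by (auto simp: prod_eq_iff)
qed

lemma pairing_piece:
  assumes "z \<in> pieces"
  shows "(\<exists>h\<in>lower_levels. z \<in> G h \<and> pairing w z = real_of_int h) \<or>
    (\<exists>h\<in>upper_levels. z \<in> level_hull w h P + dilate h F \<and> pairing w z = real_of_int h)"
proof -
  have "pairing w z = real_of_int h" if "h \<in> upper_levels" "z \<in> level_hull w h P + dilate h F" for h
    by (rule upper_piece[OF that]) (simp only: pairing_shift)
  then show ?thesis
    using assms pairing_G unfolding pieces_def by blast
qed

lemma mutated_face_eq:
  assumes "mutated_normal w f u = u" "primitive u"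
  shows "bottom_face (lattice_point u) P' = convex hull {z \<in> pieces. pairing u z = - real (height u P)}"
proof -
  have "bottom_face (lattice_point u) P' = {z \<in> convex hull pieces. lattice_point u \<bullet> z = - real (height u P)}"
    using mutated.height_props(3)[OF assms(2)] height_mutated[of u] assms(1)
    by (simp add: pairing_eq_inner mutated_polygon_eq)
  also have "\<dots> = convex hull {z \<in> pieces. lattice_point u \<bullet> z = - real (height u P)}"
    using mutated.height_props(5)[OF assms(2)] height_mutated[of u] assms(1)
    by (intro convex_hull_minimal_level) (simp add: pairing_eq_inner mutated_polygon_eq hull_inc)
  finally show ?thesis by (simp add: pairing_eq_inner)
qed

lemma convex_lattice_polytope: "lattice_polytope S \<Longrightarrow> convex S"
  by (simp add: lattice_polytope_imp_polytope polytope_imp_convex)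

text \<open>
  The edge with normal \<open>w\<close> is \<open>G (- r) + r F\<close> with \<open>r\<close> its height, and it is replaced by
  \<open>G (- r)\<close>: the width drops by \<open>r\<close>, the height stays.
\<close>

lemma T_number_contracted: "T_number P w = Suc (T_number P' w)"
proof -
  define r where "r = height w P"
  have r: "r > 0" using height_props(2)[OF w] by (simp add: r_def)
  have low: "- int r \<in> lower_levels" using r by (simp add: lower_levels_eq r_def)
  let ?G = "G (- int r)" and ?E = "bottom_face (lattice_point w) P"
  have lat_G: "lattice_polytope ?G" by (rule G_data(1)[OF low])
  have E: "?E = {x \<in> P. pairing w x = - real r}"
    using height_props(3)[OF w] by (simp add: r_def)
  have sum: "?E = ?G + dilate (int r) F"
  proof
    have "{x. x extreme_point_of P \<and> x \<in> ?E} \<subseteq> ?G + dilate (int r) F"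
      using G_data(2)[OF low] by (auto simp: E)
    then have "convex hull {x. x extreme_point_of P \<and> x \<in> ?E} \<subseteq> ?G + dilate (int r) F"
      using lat_G lattice_polytope_primitive_segment[of "int r" f]
      by (intro hull_minimal convex_set_plus convex_lattice_polytope)
    then show "?E \<subseteq> ?G + dilate (int r) F"
      using bottom_face_eq_hull_vertices[OF lattice_polytope_imp_polytope[OF lattice], of "lattice_point w"] by simp
    have "?G + dilate (int r) F \<subseteq> level_hull w (- int r) P"
      using G_data(3)[OF low] by simp
    then show "?G + dilate (int r) F \<subseteq> ?E"
      using level_hull_subset[of _ "- int r"] unfolding E by fastforce
  qed
  have "?G \<noteq> {}"
    using sum height_props(4)[OF w] by (auto simp: set_plus_def)
  have "{z \<in> pieces. pairing w z = - real r} = ?G"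
  proof
    show "{z \<in> pieces. pairing w z = - real r} \<subseteq> ?G"
    proof clarify
      fix x y assume z: "(x, y) \<in> pieces" "pairing w (x, y) = - real r"
      from pairing_piece[OF z(1)] show "(x, y) \<in> ?G"
      proof (elim disjE bexE conjE)
        fix h assume "(x, y) \<in> G h" "pairing w (x, y) = real_of_int h"
        moreover then have "h = - int r" using z(2) by linarith
        ultimately show ?thesis by simp
      next
        fix h assume "h \<in> upper_levels" "pairing w (x, y) = real_of_int h"
        then show ?thesis using z(2) r by (simp add: upper_levels_def)
      qed
    qed
    show "?G \<subseteq> {z \<in> pieces. pairing w z = - real r}"
      using low pairing_G[OF low] by (auto simp: pieces_def)
  qed
  then have "bottom_face (lattice_point w) P' = ?G"
    using mutated_face_eq[OF mutated_normal_w(1) w] convex_lattice_polytope[OF lat_G]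
    by (simp add: r_def hull_same)
  moreover have "width ?E = width ?G + r"
    unfolding sum using width_plus_dilated_segment[OF w f wf lat_G \<open>?G \<noteq> {}\<close> pairing_G[OF low], of "int r"] by simp
  moreover have "height w P' = r"
    using height_mutated[of w] by (simp add: mutated_normal_w r_def)
  ultimately show ?thesis
    using r by (simp add: T_number_def flip: r_def)
qed

text \<open>
  The face with normal \<open>-w\<close>, possibly a vertex, is at level \<open>r\<close>, where \<open>r\<close> is its height. It is
  replaced by its Minkowski sum with \<open>r F\<close>: the width grows by \<open>r\<close>, the height stays.
\<close>

lemma T_number_expanded: "T_number P' (- fst w, - snd w) = Suc (T_number P (- fst w, - snd w))"
proof -
  let ?w = "(- fst w, - snd w)"
  define r where "r = height ?w P"
  have r: "r > 0" using height_props(2)[OF w'] by (simp add: r_def)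
  have up: "int r \<in> upper_levels" by (simp add: upper_levels_eq r_def)
  let ?E = "bottom_face (lattice_point ?w) P" and ?L = "level_hull w (int r) P"
  have E: "?E = {x \<in> P. pairing w x = real r}"
    using height_props(3)[OF w'] by (simp add: r_def pairing_uminus)
  have level: "?L = ?E"
  proof
    show "?L \<subseteq> ?E" using level_hull_subset[of _ "int r"] unfolding E by auto
    have "{x. x extreme_point_of P \<and> x \<in> ?E} \<subseteq> {x \<in> P \<inter> lattice_points. pairing w x = real_of_int (int r)}"
    proof
      fix x assume x: "x \<in> {x. x extreme_point_of P \<and> x \<in> ?E}"
      then have "x extreme_point_of P" by simp
      then obtain v where "x = lattice_point v" by (rule lattice_polytope_vertex[OF lattice])
      then show "x \<in> {x \<in> P \<inter> lattice_points. pairing w x = real_of_int (int r)}"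
        using x by (simp add: E)
    qed
    then have "convex hull {x. x extreme_point_of P \<and> x \<in> ?E} \<subseteq> ?L"
      unfolding level_hull_def by (rule hull_mono)
    then show "?E \<subseteq> ?L"
      using bottom_face_eq_hull_vertices[OF lattice_polytope_imp_polytope[OF lattice], of "lattice_point ?w"] by simp
  qed
  let ?S = "?L + dilate (int r) F"
  have lat_L: "lattice_polytope ?L" by (rule lattice_polytope_level_hull)
  have "{z \<in> pieces. pairing ?w z = - real r} = ?S"
  proof
    show "{z \<in> pieces. pairing ?w z = - real r} \<subseteq> ?S"
    proof clarify
      fix x y assume z: "(x, y) \<in> pieces" "pairing ?w (x, y) = - real r"
      then have wz: "pairing w (x, y) = real r" by (simp add: pairing_uminus)
      from pairing_piece[OF z(1)] show "(x, y) \<in> ?S"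
      proof (elim disjE bexE conjE)
        fix h assume "h \<in> lower_levels" "pairing w (x, y) = real_of_int h"
        then show ?thesis using wz r by (simp add: lower_levels_def)
      next
        fix h assume "(x, y) \<in> level_hull w h P + dilate h F" "pairing w (x, y) = real_of_int h"
        moreover then have "h = int r" using wz by linarith
        ultimately show ?thesis by simp
      qed
    qed
    show "?S \<subseteq> {z \<in> pieces. pairing ?w z = - real r}"
    proof
      fix z assume z: "z \<in> ?S"
      obtain y t where "pairing w y = real_of_int (int r)" "z = y + (real_of_int (int r) * t) *\<^sub>R lattice_point f"
        by (rule upper_piece[OF up z])
      then have "pairing w z = real r" by (simp only: pairing_shift of_int_of_nat_eq)
      then show "z \<in> {z \<in> pieces. pairing ?w z = - real r}"
        using z up by (auto simp: pieces_def pairing_uminus)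
    qed
  qed
  moreover have "convex ?S"
    using lat_L lattice_polytope_primitive_segment[of "int r" f]
    by (intro convex_set_plus convex_lattice_polytope)
  ultimately have "bottom_face (lattice_point ?w) P' = ?S"
    using mutated_face_eq[OF mutated_normal_w(2) w'] by (simp add: r_def hull_same)
  moreover have "?L \<noteq> {}" using level height_props(4)[OF w'] by simp
  then have "width ?S = width ?E + r"
    using width_plus_dilated_segment[OF w f wf lat_L _ level_hull_subset(2), of "int r" "int r"] by (simp add: level)
  moreover have "height ?w P' = r"
    using height_mutated[of ?w] by (simp add: mutated_normal_w r_def)
  ultimately show ?thesis
    using r by (simp add: T_number_def flip: r_def)
qed

text \<open>
  The generator \<open>f\<close> of the kernel of \<open>w\<close> satisfies \<open>u(f) = +/- (w \<and> u)\<close>. Both signs lead to the same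
  result, since \<open>x = max x 0 - max (- x) 0\<close>; they differ by a global shear of the mutated
  polygon. The function \<open>c\<close> counts direct arrows and composite arrows through \<open>w\<close>.
\<close>

lemma wedge_mutated_normals:
  defines "c \<equiv> \<lambda>u v. max (wedge u v) 0 + max (wedge u w) 0 * max (wedge w v) 0"
  shows "wedge (mutated_normal w f u) (mutated_normal w f v) = c u v - c v u"
proof -
  have "primitive (- snd w, fst w)" using w by (simp add: primitive_def coprime_commute)
  moreover have "fst w * fst (- snd w, fst w) + snd w * snd (- snd w, fst w) = 0" by simp
  ultimately obtain j where j: "fst f = j * - snd w" "snd f = j * fst w"
    using integer_kernel[OF w _ _ wf_int] by (metis fst_conv snd_conv)
  then have "is_unit j"
    using f unfolding primitive_def coprime_def by (metis dvd_triv_left)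
  then have "j = 1 \<or> j = - 1" by auto
  have val: "fst u * fst f + snd u * snd f = j * wedge w u" for u
    unfolding j wedge_def by (simp add: algebra_simps)
  have pos_part: "min 0 (j * x) = (if j = 1 then - max (- x) 0 else - max x 0)" for x :: int
    using \<open>j = 1 \<or> j = - 1\<close> by auto
  have antisym: "wedge a b = - wedge b a" for a b by (simp add: wedge_def)
  have expand: "wedge (mutated_normal w f u) (mutated_normal w f v) =
      wedge u v - min 0 (j * wedge w v) * wedge u w - min 0 (j * wedge w u) * wedge w v"
    unfolding mutated_normal_def Let_def val by (simp add: wedge_def algebra_simps)
  have split: "x = max x 0 - max (- x) 0" for x :: int by simp
  show ?thesis
  proof (cases "j = 1")
    case True
    show ?thesis
      unfolding expand c_def pos_part antisym[of v u] antisym[of u w] antisym[of v w]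
      using split[of "wedge w u"] split[of "wedge w v"] split[of "wedge u v"] True
      by (simp add: max_def algebra_simps)
  next
    case False
    show ?thesis
      unfolding expand c_def pos_part antisym[of v u] antisym[of u w] antisym[of v w]
      using False by (simp add: max_def algebra_simps)
  qed
qed

lemma wedge_mutated_normal_w:
  "wedge (- fst w, - snd w) (mutated_normal w f u) = wedge u w"
  "wedge (mutated_normal w f u) (- fst w, - snd w) = wedge w u"
  by (simp_all add: wedge_def mutated_normal_def Let_def algebra_simps)

end

section \<open>The quiver of the mutated polygon\<close>

lemma bij_betw_of_fibre_counts:
  assumes fin: "finite A" "finite B"
    and counts: "\<And>u. card {a \<in> A. \<alpha> a = u} = card {b \<in> B. \<beta> b = u}"
  obtains g where "bij_betw g A B" "\<forall>a\<in>A. \<beta> (g a) = \<alpha> a"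
proof -
  have "\<exists>k. bij_betw k {a \<in> A. \<alpha> a = u} {b \<in> B. \<beta> b = u}" for u
    using fin counts by (intro finite_same_card_bij) auto
  then obtain k where k: "\<And>u. bij_betw (k u) {a \<in> A. \<alpha> a = u} {b \<in> B. \<beta> b = u}"
    by metis
  define g where "g a = k (\<alpha> a) a" for a
  have g: "g a \<in> B" "\<beta> (g a) = \<alpha> a" if "a \<in> A" for a
    using bij_betwE[OF k[of "\<alpha> a"]] that by (auto simp: g_def)
  have "inj_on g A"
  proof (rule inj_onI)
    fix a b assume ab: "a \<in> A" "b \<in> A" "g a = g b"
    then have "\<alpha> a = \<alpha> b" using g(2) by metis
    then show "a = b"
      using ab k[of "\<alpha> a"] unfolding bij_betw_def g_def by (auto dest: inj_onD)
  qed
  moreover have "B \<subseteq> g ` A"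
  proof
    fix b assume "b \<in> B"
    then have "b \<in> k (\<beta> b) ` {a \<in> A. \<alpha> a = \<beta> b}"
      using k[of "\<beta> b"] by (simp add: bij_betw_def)
    then obtain a where "a \<in> A" "\<alpha> a = \<beta> b" "b = k (\<beta> b) a" by blast
    then show "b \<in> g ` A" by (intro image_eqI[of _ _ a]) (simp_all add: g_def)
  qed
  then have "g ` A = B" using g(1) by auto
  ultimately have "bij_betw g A B" by (simp add: bij_betw_def)
  then show ?thesis using that g(2) by blast
qed

lemma fano_imp_lattice_polygon:
  assumes "fano_polygon P" shows "lattice_polygon P"
proof
  have P: "polytope P" using assms by (simp add: fano_polygon_def)
  have "{x. x extreme_point_of P} \<subseteq> lattice_points"
    using assms lattice_point_in_lattice_points unfolding fano_polygon_def by blast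
  then have "lattice_polytope (convex hull {x. x extreme_point_of P})"
    using finite_vertices[OF P] by (intro lattice_polytope_hull)
  then show "lattice_polytope P" by (simp add: hull_vertices_eq[OF P])
  show "0 \<in> interior P" using assms by (simp add: fano_polygon_def)
qed

lemma arrows_polygon_quiver:
  assumes "C \<in> primitive_T_cones P \<sigma>" "D \<in> primitive_T_cones P \<sigma>"
  shows "arrows (polygon_quiver P \<sigma>) C D =
    (\<lambda>i. (C, D, i)) ` {..<nat (wedge (cone_normal P C) (cone_normal P D))}"
  using assms by (auto simp: arrows_def polygon_quiver_def)

lemma card_arrows_polygon_quiver:
  assumes "C \<in> primitive_T_cones P \<sigma>" "D \<in> primitive_T_cones P \<sigma>"
  shows "card (arrows (polygon_quiver P \<sigma>) C D) = nat (wedge (cone_normal P C) (cone_normal P D))"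
  unfolding arrows_polygon_quiver[OF assms] by (simp add: card_image inj_on_def)

lemma verts_polygon_quiver: "verts (polygon_quiver P \<sigma>) = primitive_T_cones P \<sigma>"
  by (simp add: polygon_quiver_def)

lemma wf_digraph_polygon_quiver: "wf_digraph (polygon_quiver P \<sigma>)"
  by unfold_locales (auto simp: polygon_quiver_def)

lemma finite_arcs_polygon_quiver:
  assumes "finite (primitive_T_cones P \<sigma>)"
  shows "finite (arcs (polygon_quiver P \<sigma>))"
proof -
  let ?T = "primitive_T_cones P \<sigma>"
  have "arcs (polygon_quiver P \<sigma>) \<subseteq> (\<Union>C\<in>?T. \<Union>D\<in>?T. arrows (polygon_quiver P \<sigma>) C D)"
    by (auto simp: polygon_quiver_def arrows_def)
  moreover have "finite (\<Union>C\<in>?T. \<Union>D\<in>?T. arrows (polygon_quiver P \<sigma>) C D)"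
    using assms by (auto simp: arrows_polygon_quiver)
  ultimately show ?thesis by (rule finite_subset)
qed

lemma wedge_self [simp]: "wedge u u = 0"
  by (simp add: wedge_def)

lemma wedge_antisym: "wedge u v = - wedge v u"
  by (simp add: wedge_def)

text \<open>
  Here \<open>\<mu>\<close> is the label that a T-cone of \<open>P\<close> receives after the mutation. Since \<open>\<phi>\<close> is a
  bijection of primitive covectors fixing \<open>w\<close> and \<open>-w\<close>, only the fibres over these two see that \<open>C\<close> is
  relabelled: \<open>w\<close> loses \<open>C\<close> and \<open>-w\<close> gains it.
\<close>

lemma (in mutation_setting) T_cone_multiplicities:
  assumes \<sigma>: "polygon_subdivision P \<sigma>" and \<sigma>': "polygon_subdivision P' \<sigma>'"
    and C: "C \<in> primitive_T_cones P \<sigma>" and Cw: "cone_normal P C = w"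
  defines "\<mu> \<equiv> \<lambda>D. if D = C then (- fst w, - snd w) else mutated_normal w f (cone_normal P D)"
  shows "card {D \<in> primitive_T_cones P' \<sigma>'. cone_normal P' D = u} =
         card {D \<in> primitive_T_cones P \<sigma>. \<mu> D = u}"
proof (cases "primitive u")
  case False
  have "\<mu> D \<noteq> u" if "D \<in> primitive_T_cones P \<sigma>" for D
    using False w' primitive_mutated_normal[OF primitive_cone_normal[OF \<sigma> that]] by (auto simp: \<mu>_def)
  moreover have "cone_normal P' D \<noteq> u" if "D \<in> primitive_T_cones P' \<sigma>'" for D
    using False mutated.primitive_cone_normal[OF \<sigma>' that] by blast
  ultimately have "{D \<in> primitive_T_cones P \<sigma>. \<mu> D = u} = {}"
    "{D \<in> primitive_T_cones P' \<sigma>'. cone_normal P' D = u} = {}" by auto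
  then show ?thesis by (simp only:)
next
  case True
  let ?T = "\<lambda>v. {D \<in> primitive_T_cones P \<sigma>. cone_normal P D = v}"
  have fin: "finite (?T v)" for v
    using finite_primitive_T_cones[OF \<sigma>] by simp
  have ww: "w \<noteq> (- fst w, - snd w)"
    using w by (auto simp: primitive_def prod_eq_iff)
  obtain v where v: "primitive v" "mutated_normal w f v = u"
    by (rule mutated_normal_surj[OF True])
  have \<mu>_eq: "mutated_normal w f (cone_normal P D) = u \<longleftrightarrow> cone_normal P D = v" for D
    using v(2) mutated_normal_inj by blast
  have "card {D \<in> primitive_T_cones P \<sigma>. \<mu> D = u} = T_number P' u"
  proof (cases "fst v * fst f + snd v * snd f = 0")
    case False
    have "v \<noteq> w" "v \<noteq> (- fst w, - snd w)"
      using False wf_int by auto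
    moreover then have "u \<noteq> (- fst w, - snd w)"
      using v(2) mutated_normal_w(2) mutated_normal_inj by metis
    ultimately have "{D \<in> primitive_T_cones P \<sigma>. \<mu> D = u} = ?T v"
      using Cw by (auto simp: \<mu>_def \<mu>_eq)
    then show ?thesis
      using card_T_cones_with_normal[OF \<sigma> v(1)] T_number_generic[OF False] v(2) by simp
  next
    case True
    then consider "v = w" | "v = (- fst w, - snd w)"
      using kernel_normals[OF v(1)] by blast
    then show ?thesis
    proof cases
      case 1
      then have u: "u = w" using v(2) mutated_normal_w(1) by simp
      have "\<mu> D = u \<longleftrightarrow> D \<noteq> C \<and> cone_normal P D = w" for D
      proof (cases "D = C")
        case True
        then show ?thesis using ww u by (simp add: \<mu>_def)
      next
        case False
        then show ?thesis using \<mu>_eq[of D] unfolding \<mu>_def 1 by simp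
      qed
      then have "{D \<in> primitive_T_cones P \<sigma>. \<mu> D = u} = ?T w - {C}"
        by blast
      then have "card {D \<in> primitive_T_cones P \<sigma>. \<mu> D = u} = card (?T w) - 1"
        using C Cw fin by (simp add: card_Diff_singleton)
      then show ?thesis
        using card_T_cones_with_normal[OF \<sigma> w] T_number_contracted u by simp
    next
      case 2
      then have u: "u = (- fst w, - snd w)" using v(2) mutated_normal_w(2) by simp
      have "\<mu> D = u \<longleftrightarrow> D = C \<or> cone_normal P D = (- fst w, - snd w)" for D
      proof (cases "D = C")
        case True
        then show ?thesis using u by (simp add: \<mu>_def)
      next
        case False
        then show ?thesis using \<mu>_eq[of D] unfolding \<mu>_def 2 by simp
      qed
      then have "{D \<in> primitive_T_cones P \<sigma>. \<mu> D = u} = insert C (?T (- fst w, - snd w))"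
        using C by blast
      moreover have "C \<notin> ?T (- fst w, - snd w)" using Cw ww by simp
      ultimately have "card {D \<in> primitive_T_cones P \<sigma>. \<mu> D = u} = Suc (card (?T (- fst w, - snd w)))"
        using fin by simp
      then show ?thesis
        using card_T_cones_with_normal[OF \<sigma> w'] T_number_expanded u by simp
    qed
  qed
  then show ?thesis
    using mutated.card_T_cones_with_normal[OF \<sigma>' True] by simp
qed

text \<open>
  There are no arrows between \<open>C\<close> and itself, hence no composite arrows that start or end at \<open>C\<close>
  and no two-cycles through \<open>C\<close>, and only the reversal affects the arrows at \<open>C\<close>.
\<close>

lemma (in mutation_setting) mutated_quiver_arrow_counts:
  assumes \<sigma>: "polygon_subdivision P \<sigma>"
    and C: "C \<in> primitive_T_cones P \<sigma>" and Cw: "cone_normal P C = w"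
    and Q': "quiver_mutation (polygon_quiver P \<sigma>) C Q'"
    and x: "x \<in> primitive_T_cones P \<sigma>" and y: "y \<in> primitive_T_cones P \<sigma>"
  defines "\<mu> \<equiv> \<lambda>D. if D = C then (- fst w, - snd w) else mutated_normal w f (cone_normal P D)"
  shows "card (arrows Q' x y) = nat (wedge (\<mu> x) (\<mu> y))"
proof (cases "x = y")
  case True
  have "arrows (polygon_quiver P \<sigma>) x x = {}"
    using arrows_polygon_quiver[OF x x] by simp
  moreover have "arrows (polygon_quiver P \<sigma>) x C = {} \<or> arrows (polygon_quiver P \<sigma>) C x = {}"
    using arrows_polygon_quiver[OF x C] arrows_polygon_quiver[OF C x]
      wedge_antisym[of "cone_normal P x" "cone_normal P C"] by (cases "wedge (cone_normal P x) (cone_normal P C) \<le> 0") auto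
  ultimately have "arrows Q' x x = {}"
    by (rule quiver_mutation_loops[OF Q'])
  then show ?thesis using True by simp
next
  case False
  let ?\<nu> = "cone_normal P"
  have fin: "finite (arcs (polygon_quiver P \<sigma>))"
    by (rule finite_arcs_polygon_quiver[OF finite_primitive_T_cones[OF \<sigma>]])
  note counts = quiver_mutation_arrow_counts[OF Q' fin False]
    card_arrows_polygon_quiver[OF x y] card_arrows_polygon_quiver[OF y x]
    card_arrows_polygon_quiver[OF x C] card_arrows_polygon_quiver[OF C x]
    card_arrows_polygon_quiver[OF y C] card_arrows_polygon_quiver[OF C y]
    card_arrows_polygon_quiver[OF C C]
  consider "x = C" | "y = C" "x \<noteq> C" | "x \<noteq> C" "y \<noteq> C" by blast
  then show ?thesis
  proof cases
    case 1
    then show ?thesis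
      using False Cw counts wedge_antisym[of w "?\<nu> y"] by (simp add: \<mu>_def wedge_mutated_normal_w)
  next
    case 2
    then show ?thesis
      using False Cw counts wedge_antisym[of w "?\<nu> x"] by (simp add: \<mu>_def wedge_mutated_normal_w)
  next
    case 3
    let ?c = "\<lambda>u v. nat (wedge u v) + nat (wedge u w) * nat (wedge w v)"
    have c: "max (wedge u v) 0 + max (wedge u w) 0 * max (wedge w v) 0 = int (?c u v)" for u v
      by simp
    have "card (arrows Q' x y) = ?c (?\<nu> x) (?\<nu> y) - ?c (?\<nu> y) (?\<nu> x)"
      using 3 counts by (simp add: Cw)
    moreover have "wedge (\<mu> x) (\<mu> y) = int (?c (?\<nu> x) (?\<nu> y)) - int (?c (?\<nu> y) (?\<nu> x))"
      using 3 wedge_mutated_normals[of "?\<nu> x" "?\<nu> y"] unfolding c by (simp add: \<mu>_def)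
    ultimately show ?thesis by linarith
  qed
qed

theorem proposition3p17:
  fixes P P' C :: "(real \<times> real) set"
    and \<sigma> \<sigma>' :: "(real \<times> real) set \<Rightarrow> (real \<times> real) set set"
  assumes "fano_polygon P"
    and "polygon_subdivision P \<sigma>"
    and "C \<in> verts (polygon_quiver P \<sigma>)"
    and "polygon_mutation P (cone_normal P C) P'"
    and "polygon_subdivision P' \<sigma>'"
    and "quiver_mutation (polygon_quiver P \<sigma>) C Q'"
  shows "digraph_iso (polygon_quiver P' \<sigma>') Q'"
proof -
  interpret lattice_polygon P by (rule fano_imp_lattice_polygon[OF assms(1)])
  have C: "C \<in> primitive_T_cones P \<sigma>" using assms(3) by (simp add: verts_polygon_quiver)
  define w where "w = cone_normal P C"
  obtain f G where f: "primitive f" "pairing w (lattice_point f) = 0"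
    and data: "mutation_data P w (convex hull {0, lattice_point f}) G"
    and P': "P' = mutated_polygon P w (convex hull {0, lattice_point f}) G"
    using assms(4) unfolding polygon_mutation_def w_def by blast
  have w: "primitive w" using primitive_cone_normal[OF assms(2) C] by (simp add: w_def)
  interpret mutation_setting P w f G
    by unfold_locales (use w f data in auto)
  define \<mu> where "\<mu> = (\<lambda>D. if D = C then (- fst w, - snd w) else mutated_normal w f (cone_normal P D))"
  have \<sigma>': "polygon_subdivision (mutated_polygon P w (convex hull {0, lattice_point f}) G) \<sigma>'"
    using assms(5) by (simp add: P')
  have fin': "finite (primitive_T_cones P' \<sigma>')"
    using mutated.finite_primitive_T_cones[OF \<sigma>'] by (simp add: P')
  have fin: "finite (primitive_T_cones P \<sigma>)" by (rule finite_primitive_T_cones[OF assms(2)])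
  have counts: "card {D \<in> primitive_T_cones P' \<sigma>'. cone_normal P' D = u} = card {D \<in> primitive_T_cones P \<sigma>. \<mu> D = u}" for u
    using T_cone_multiplicities[OF assms(2) \<sigma>' C w_def[symmetric]] unfolding \<mu>_def P' .
  obtain g where g: "bij_betw g (primitive_T_cones P' \<sigma>') (primitive_T_cones P \<sigma>)"
    and normals: "\<forall>D\<in>primitive_T_cones P' \<sigma>'. \<mu> (g D) = cone_normal P' D"
    by (rule bij_betw_of_fibre_counts[OF fin' fin counts])
  have arcs: "card (arrows (polygon_quiver P' \<sigma>') x y) = card (arrows Q' (g x) (g y))"
    if "x \<in> primitive_T_cones P' \<sigma>'" "y \<in> primitive_T_cones P' \<sigma>'" for x y
  proof -
    have "g x \<in> primitive_T_cones P \<sigma>" "g y \<in> primitive_T_cones P \<sigma>"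
      using g that by (auto dest: bij_betwE)
    then have "card (arrows Q' (g x) (g y)) = nat (wedge (\<mu> (g x)) (\<mu> (g y)))"
      unfolding \<mu>_def by (rule mutated_quiver_arrow_counts[OF assms(2) C w_def[symmetric] assms(6)])
    then show ?thesis
      using card_arrows_polygon_quiver[OF that] normals that by simp
  qed
  show ?thesis
  proof (rule digraph_iso_of_arrow_counts)
    show "wf_digraph Q'"
      by (rule wf_digraph_quiver_mutation[OF assms(6) wf_digraph_polygon_quiver])
    show "finite (arcs Q')"
      by (rule finite_arcs_quiver_mutation[OF assms(6) finite_arcs_polygon_quiver[OF fin]])
    show "bij_betw g (verts (polygon_quiver P' \<sigma>')) (verts Q')"
      using g verts_quiver_mutation[OF assms(6)] by (simp add: verts_polygon_quiver)
  qed (use arcs in \<open>simp_all add: verts_polygon_quiver wf_digraph_polygon_quiver finite_arcs_polygon_quiver[OF fin']\<close>)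
qed

end
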